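(* Let $L\ge m>0$ and integers $n,p\ge1$ be given. Let $C=D=\begin{bmatrix}1&0&\cdots&0\end{bmatrix}\otimes I_p\in\mathbb{R}^{p\times np}$ and $D^\dagger=C^\top\in\mathbb{R}^{np\times p}$. Fix $\rho\in(0,1)$ and let $\ell_-,\ell_+\in\mathbb{N}$. Suppose there exist $P_{11}=P_{11}^\top\in\mathbb{R}^{p(\ell_-+\ell_+)\times p(\ell_-+\ell_+)}$, $P_{22}=P_{22}^\top\in\mathbb{R}^{np\times np}$, $Q_A\in\mathbb{R}^{np\times np}$, $Q_B\in\mathbb{R}^{np\times p}$, $M_+\in\mathbb{R}^{p\times\ell_+p}$, $M_-\in\mathbb{R}^{p\times\ell_-p}$, $M_0\in\mathbb{R}^{p\times p}$ such that $$\begin{bmatrix}-P_{22}&\begin{bmatrix}0&\rho^{-1}Q_A+m\rho^{-1}Q_BC&Q_B\end{bmatrix}\\ \star&U(P,M_\Delta)\end{bmatrix}\prec0,\qquad P=\mathrm{blkdiag}(P_{11},P_{22}),$$ $$(Q_A-P_{22})D^\dagger=0,\qquad\begin{bmatrix}M_-&M_0&M_+\end{bmatrix}\in\mathbb{M}(\rho,\ell_+,\ell_-,p).$$ Then, with $A=P_{22}^{-1}Q_A$ and $B=P_{22}^{-1}Q_B$, the equilibrium $x^\star=D^\dagger z^\star$ of the algorithm $x_{k+1}=Ax_k+B\nabla H(Cx_k)$ is globally robustly exponentially stable with rate $\rho$ over $H\in\mathcal{S}_{m,L}$; that is, in terms of $\xi_k=x_k-D^\dagger z^\star$, the origin of $$\xi_{k+1}=(A+mBC)\xi_k+Bw_k,\quad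 y_k=C\xi_k,\quad w_k=\Delta_H(y)_k$$ is robustly exponentially stable against $\{\Delta_H:H\in\mathcal{S}_{m,L}\}$ with rate $\rho$.
   Context: $\mathbb{N}$ includes $0$; $\star$ denotes a block determined by symmetry. $\mathcal{S}_{m,L}$: functions $H:\mathbb{R}^p\to\mathbb{R}$, $H\in\mathcal{C}^2$, with $(\nabla H(x)-\nabla H(y))^\top(x-y)\ge m\|x-y\|^2$ and $\|\nabla H(x)-\nabla H(y)\|\le L\|x-y\|$ for all $x,y$; $z^\star$ is the unique minimizer of $H$; $\Delta_H(y)_k=\nabla H(y_k+z^\star)-my_k$. Robust exponential stability with rate $\rho$: there exists $\eta>0$ such that $\|\xi_k\|^2\le\eta\rho^{2k}\|\xi_0\|^2$ for all $k\in\mathbb{N}$, all $\xi_0\in\mathbb{R}^{np}$ and all $H\in\mathcal{S}_{m,L}$. $\mathbb{M}(\rho,\ell_+,\ell_-,p)$ is the set of $[M_{-\ell_-}\cdots M_{\ell_+}]$ with $M_i=m_iI_p$, $m_i\le0$ for $i\ne0$, $(\sum_{i=-\ell_-}^{\ell_+}M_i\rho^{-i})\mathbf{1}\ge0$, $\mathbf{1}^\top(\sum_{i=-\ell_-}^{\ell_+}M_i\rho^i)\ge0$ (elementwise). $M_-=[M_{-\ell_-}\cdots M_{-1}]$, $M_+=[M_1^\top\cdots M_{\ell_+}^\top]$. $$M_\Delta=\mathrm{blkdiag}\left(\begin{bmatrix}0&M_0^\top\\ M_0&0\end{bmatrix},\begin{bmatrix}0&M_-^\top\\ M_-&0\end{bmatrix},\begin{bmatrix}0&M_+\\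 M_+^\top&0\end{bmatrix}\right),$$ with block sizes $(p,p,\ell_-p,p,p,\ell_+p)$. Let $S_\ell\in\mathbb{R}^{\ell\times\ell}$ have ones on the first superdiagonal and zeros elsewhere, $e_\ell=[0,\dots,0,1]^\top\in\mathbb{R}^\ell$, $J_\ell$ the $\ell\times\ell$ matrix with ones on the antidiagonal and zeros elsewhere (blocks of dimension zero are omitted). Put $\widehat W=\begin{bmatrix}(L-m)I_p&-I_p\\ 0&I_p\end{bmatrix}$, $$A_\Delta=\begin{bmatrix}S_{\ell_-}&0\\ 0&S_{\ell_+}\end{bmatrix}\otimes I_p,\quad B_\Delta=\begin{bmatrix}e_{\ell_-}\otimes I_p&0\\ 0&e_{\ell_+}\otimes I_p\end{bmatrix}\widehat W,\quad C_\Delta=\begin{bmatrix}0&0\\ 0&0\\ I_{\ell_-p}&0\\ 0&0\\ 0&0\\ 0&J_{\ell_+}\otimes I_p\end{bmatrix},\quad D_\Delta=\begin{bmatrix}I_p&0\\ 0&I_p\\ 0&0\\ 0&I_p\\ I_p&0\\ 0&0\end{bmatrix}\widehat W,$$ block rows of $C_\Delta,D_\Delta$ having sizes $(p,p,\ell_-p,p,p,\ell_+p)$. With $$F(\rho)=\begin{bmatrix}A_\Delta&\rho^{-1}B_\Delta\begin{bmatrix}C\\ 0\end{bmatrix}&B_\Delta\begin{bmatrix}0\\ I_p\end{bmatrix}\end{bmatrix},\qquad K(\rho)=\begin{bmatrix}C_\Delta&\rho^{-1}D_\Delta\begin{bmatrix}C\\ 0\end{bmatrix}&D_\Delta\begin{bmatrix}0\\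 I_p\end{bmatrix}\end{bmatrix},$$ for block-diagonal $P=\mathrm{blkdiag}(P_{11},P_{22})$ set $$U(P,M_\Delta)=F(\rho)^\top P_{11}F(\rho)-\mathrm{blkdiag}(P_{11},P_{22},0_p)+K(\rho)^\top M_\Delta K(\rho).$$ *)

theory Defs
  imports "HOL-Analysis.Analysis" "Jordan_Normal_Form.Gauss_Jordan_Elimination"
begin

text \<open>
  Block matrices whose sizes depend on \<open>n\<close>, \<open>p\<close>, \<open>\<ell>\<^sub>-\<close>, \<open>\<ell>\<^sub>+\<close> (the latter two may be \<open>0\<close>) are
  carrier-based matrices \<^typ>\<open>real mat\<close>; blocks of dimension zero are legitimate there.
  Functions on \<open>\<real>\<^sup>p\<close> live on \<^typ>\<open>real^'p\<close> with \<open>p = CARD('p)\<close>, where the differential calculus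
  of HOL-Analysis is available. The parameters \<open>lm\<close>, \<open>lp\<close> stand for \<open>\<ell>\<^sub>-\<close>, \<open>\<ell>\<^sub>+\<close>.
\<close>

unbundle no vec_syntax

text \<open>The two maps use the same enumeration of the index type \<open>'p\<close> by \<open>{..<CARD('p)}\<close>
  and are inverse to each other on vectors of dimension \<open>CARD('p)\<close>.\<close>

definition to_vec :: "real^'p \<Rightarrow> real Matrix.vec" where
  "to_vec x = Matrix.vec CARD('p) (\<lambda>i. vec_nth x (from_nat_into UNIV i))"

definition of_vec :: "real Matrix.vec \<Rightarrow> real^'p" where
  "of_vec v = vec_lambda (\<lambda>j. vec_index v (to_nat_on UNIV j))"

definition gradient :: "(real^'p \<Rightarrow> real) \<Rightarrow> real^'p \<Rightarrow> real^'p" where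
  "gradient H x = (THE g. GDERIV H x :> g)"

definition twice_cont_diff :: "(real^'p \<Rightarrow> real) \<Rightarrow> bool" where
  "twice_cont_diff H \<longleftrightarrow>
     (\<forall>x. H differentiable (at x)) \<and>
     (\<forall>x. gradient H differentiable (at x)) \<and>
     continuous_on UNIV (\<lambda>x. jacobian (gradient H) (at x))"

definition S_class :: "real \<Rightarrow> real \<Rightarrow> (real^'p \<Rightarrow> real) set" where
  "S_class m L = {H. twice_cont_diff H \<and>
     (\<forall>x y. inner (gradient H x - gradient H y) (x - y) \<ge> m * (norm (x - y))\<^sup>2) \<and>
     (\<forall>x y. norm (gradient H x - gradient H y) \<le> L * norm (x - y))}"

text \<open>For \<open>m > 0\<close> every \<open>H\<close> in the class has exactly one minimizer, so the choice in
  \<^const>\<open>arg_min\<close> is immaterial.\<close>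

definition minimizer :: "(real^'p \<Rightarrow> real) \<Rightarrow> real^'p" where
  "minimizer H = arg_min H (\<lambda>_. True)"

definition Delta :: "real \<Rightarrow> (real^'p \<Rightarrow> real) \<Rightarrow> (nat \<Rightarrow> real Matrix.vec) \<Rightarrow> nat \<Rightarrow> real Matrix.vec" where
  "Delta m H y k = to_vec (gradient H (of_vec (y k) + minimizer H)) - m \<cdot>\<^sub>v y k"

text \<open>Squared Euclidean norms are written \<open>scalar_prod v v\<close>.\<close>

definition robustly_exp_stable ::
  "real mat \<Rightarrow> real mat \<Rightarrow> real mat \<Rightarrow> ((nat \<Rightarrow> real Matrix.vec) \<Rightarrow> nat \<Rightarrow> real Matrix.vec) set \<Rightarrow> real \<Rightarrow> bool"
  where
  "robustly_exp_stable Ac B C \<D> \<rho> \<longleftrightarrow>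
     (\<exists>\<eta>>0. \<forall>\<Delta>\<in>\<D>. \<forall>\<xi> y w.
        \<xi> 0 \<in> carrier_vec (dim_col Ac) \<and>
        (\<forall>k. \<xi> (Suc k) = Ac *\<^sub>v \<xi> k + B *\<^sub>v w k \<and> y k = C *\<^sub>v \<xi> k \<and> w k = \<Delta> y k) \<longrightarrow>
        (\<forall>k. scalar_prod (\<xi> k) (\<xi> k) \<le> \<eta> * \<rho> ^ (2 * k) * scalar_prod (\<xi> 0) (\<xi> 0)))"

text \<open>Stability of the equilibria \<open>D\<^sup>\<dagger> z\<^sup>\<star>\<close> of \<open>x\<^sub>k\<^sub>+\<^sub>1 = A x\<^sub>k + B \<nabla>H(C x\<^sub>k)\<close>, uniformly over
  \<open>H \<in> \<H>\<close>; this includes the claim that \<open>D\<^sup>\<dagger> z\<^sup>\<star>\<close> is an equilibrium.\<close>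

definition algorithm_step ::
  "real mat \<Rightarrow> real mat \<Rightarrow> real mat \<Rightarrow> (real^'p \<Rightarrow> real) \<Rightarrow> real Matrix.vec \<Rightarrow> real Matrix.vec" where
  "algorithm_step A B C H x = A *\<^sub>v x + B *\<^sub>v to_vec (gradient H (of_vec (C *\<^sub>v x)))"

definition equilibrium_robustly_exp_stable ::
  "real mat \<Rightarrow> real mat \<Rightarrow> real mat \<Rightarrow> real mat \<Rightarrow> (real^'p \<Rightarrow> real) set \<Rightarrow> real \<Rightarrow> bool" where
  "equilibrium_robustly_exp_stable A B C Dd \<H> \<rho> \<longleftrightarrow>
     (\<forall>H\<in>\<H>. algorithm_step A B C H (Dd *\<^sub>v to_vec (minimizer H)) = Dd *\<^sub>v to_vec (minimizer H)) \<and>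
     (\<exists>\<eta>>0. \<forall>H\<in>\<H>. \<forall>x.
        x 0 \<in> carrier_vec (dim_col A) \<and> (\<forall>k. x (Suc k) = algorithm_step A B C H (x k)) \<longrightarrow>
        (\<forall>k. let \<xi> = (\<lambda>j. x j - Dd *\<^sub>v to_vec (minimizer H)) in
           scalar_prod (\<xi> k) (\<xi> k) \<le> \<eta> * \<rho> ^ (2 * k) * scalar_prod (\<xi> 0) (\<xi> 0)))"

definition neg_def :: "real mat \<Rightarrow> bool" where
  "neg_def X \<longleftrightarrow> X \<in> carrier_mat (dim_row X) (dim_row X) \<and> X\<^sup>T = X \<and>
     (\<forall>v \<in> carrier_vec (dim_row X). v \<noteq> 0\<^sub>v (dim_row X) \<longrightarrow> scalar_prod v (X *\<^sub>v v) < 0)"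

definition kron :: "real mat \<Rightarrow> real mat \<Rightarrow> real mat" (infixl \<open>\<otimes>\<^sub>m\<close> 75) where
  "X \<otimes>\<^sub>m Y = Matrix.mat (dim_row X * dim_row Y) (dim_col X * dim_col Y)
     (\<lambda>(i, j). X $$ (i div dim_row Y, j div dim_col Y) * Y $$ (i mod dim_row Y, j mod dim_col Y))"

definition append_cols :: "real mat \<Rightarrow> real mat \<Rightarrow> real mat" (infixr \<open>@\<^sub>c\<close> 66) where
  "X @\<^sub>c Y = four_block_mat X Y (0\<^sub>m 0 (dim_col X)) (0\<^sub>m 0 (dim_col Y))"

definition first_block :: "nat \<Rightarrow> nat \<Rightarrow> real mat" where
  "first_block n p = mat_of_row (unit_vec n 0) \<otimes>\<^sub>m 1\<^sub>m p"

definition shift_mat :: "nat \<Rightarrow> real mat" where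
  "shift_mat l = Matrix.mat l l (\<lambda>(i, j). if j = Suc i then 1 else 0)"

definition last_unit_col :: "nat \<Rightarrow> real mat" where
  "last_unit_col l = Matrix.mat l 1 (\<lambda>(i, j). if Suc i = l then 1 else 0)"

definition exchange_mat :: "nat \<Rightarrow> real mat" where
  "exchange_mat l = Matrix.mat l l (\<lambda>(i, j). if Suc (i + j) = l then 1 else 0)"

text \<open>The elements are the block rows \<open>[M (-lm) \<dots> M lp]\<close>. On vectors, \<open>0\<^sub>v p \<le> v\<close> is the elementwise order
  together with equality of dimensions; the condition on \<open>\<one>\<^sup>T(\<dots>)\<close> is stated for its transpose.\<close>

definition multiplier_set :: "real \<Rightarrow> nat \<Rightarrow> nat \<Rightarrow> nat \<Rightarrow> real mat set" where
  "multiplier_set \<rho> lp lm p =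
     {foldr (@\<^sub>c) (map M [- int lm..int lp]) (0\<^sub>m p 0) | M :: int \<Rightarrow> real mat.
       (\<exists>c :: int \<Rightarrow> real. \<forall>i\<in>{- int lm..int lp}. M i = c i \<cdot>\<^sub>m 1\<^sub>m p \<and> (i \<noteq> 0 \<longrightarrow> c i \<le> 0)) \<and>
       0\<^sub>v p \<le> Matrix.mat p p (\<lambda>ab. \<Sum>i\<in>{- int lm..int lp}. M i $$ ab * \<rho> powi (- i))
                  *\<^sub>v Matrix.vec p (\<lambda>_. 1) \<and>
       0\<^sub>v p \<le> (Matrix.mat p p (\<lambda>ab. \<Sum>i\<in>{- int lm..int lp}. M i $$ ab * \<rho> powi i))\<^sup>T
                  *\<^sub>v Matrix.vec p (\<lambda>_. 1)}"

definition M_Delta :: "nat \<Rightarrow> nat \<Rightarrow> nat \<Rightarrow> real mat \<Rightarrow> real mat \<Rightarrow> real mat \<Rightarrow> real mat" where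
  "M_Delta p lm lp Mm M0 Mp = diag_block_mat
     [four_block_mat (0\<^sub>m p p) (M0\<^sup>T) M0 (0\<^sub>m p p),
      four_block_mat (0\<^sub>m (lm * p) (lm * p)) (Mm\<^sup>T) Mm (0\<^sub>m p p),
      four_block_mat (0\<^sub>m p p) Mp (Mp\<^sup>T) (0\<^sub>m (lp * p) (lp * p))]"

definition W_hat :: "real \<Rightarrow> real \<Rightarrow> nat \<Rightarrow> real mat" where
  "W_hat m L p = four_block_mat ((L - m) \<cdot>\<^sub>m 1\<^sub>m p) (- 1\<^sub>m p) (0\<^sub>m p p) (1\<^sub>m p)"

definition A_Delta :: "nat \<Rightarrow> nat \<Rightarrow> nat \<Rightarrow> real mat" where
  "A_Delta p lm lp = diag_block_mat [shift_mat lm, shift_mat lp] \<otimes>\<^sub>m 1\<^sub>m p"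

definition B_Delta :: "real \<Rightarrow> real \<Rightarrow> nat \<Rightarrow> nat \<Rightarrow> nat \<Rightarrow> real mat" where
  "B_Delta m L p lm lp =
     diag_block_mat [last_unit_col lm \<otimes>\<^sub>m 1\<^sub>m p, last_unit_col lp \<otimes>\<^sub>m 1\<^sub>m p] * W_hat m L p"

definition C_Delta :: "nat \<Rightarrow> nat \<Rightarrow> nat \<Rightarrow> real mat" where
  "C_Delta p lm lp =
     (0\<^sub>m p (lm * p) @\<^sub>c 0\<^sub>m p (lp * p)) @\<^sub>r
     (0\<^sub>m p (lm * p) @\<^sub>c 0\<^sub>m p (lp * p)) @\<^sub>r
     (1\<^sub>m (lm * p) @\<^sub>c 0\<^sub>m (lm * p) (lp * p)) @\<^sub>r
     (0\<^sub>m p (lm * p) @\<^sub>c 0\<^sub>m p (lp * p)) @\<^sub>r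
     (0\<^sub>m p (lm * p) @\<^sub>c 0\<^sub>m p (lp * p)) @\<^sub>r
     (0\<^sub>m (lp * p) (lm * p) @\<^sub>c (exchange_mat lp \<otimes>\<^sub>m 1\<^sub>m p))"

definition D_Delta :: "real \<Rightarrow> real \<Rightarrow> nat \<Rightarrow> nat \<Rightarrow> nat \<Rightarrow> real mat" where
  "D_Delta m L p lm lp =
     ((1\<^sub>m p @\<^sub>c 0\<^sub>m p p) @\<^sub>r
      (0\<^sub>m p p @\<^sub>c 1\<^sub>m p) @\<^sub>r
      (0\<^sub>m (lm * p) p @\<^sub>c 0\<^sub>m (lm * p) p) @\<^sub>r
      (0\<^sub>m p p @\<^sub>c 1\<^sub>m p) @\<^sub>r
      (1\<^sub>m p @\<^sub>c 0\<^sub>m p p) @\<^sub>r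
      (0\<^sub>m (lp * p) p @\<^sub>c 0\<^sub>m (lp * p) p)) * W_hat m L p"

definition F_mat :: "real \<Rightarrow> real \<Rightarrow> nat \<Rightarrow> nat \<Rightarrow> nat \<Rightarrow> nat \<Rightarrow> real mat \<Rightarrow> real \<Rightarrow> real mat" where
  "F_mat m L n p lm lp C \<rho> =
     A_Delta p lm lp @\<^sub>c
     (1 / \<rho>) \<cdot>\<^sub>m (B_Delta m L p lm lp * (C @\<^sub>r 0\<^sub>m p (n * p))) @\<^sub>c
     (B_Delta m L p lm lp * (0\<^sub>m p p @\<^sub>r 1\<^sub>m p))"

definition K_mat :: "real \<Rightarrow> real \<Rightarrow> nat \<Rightarrow> nat \<Rightarrow> nat \<Rightarrow> nat \<Rightarrow> real mat \<Rightarrow> real \<Rightarrow> real mat" where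
  "K_mat m L n p lm lp C \<rho> =
     C_Delta p lm lp @\<^sub>c
     (1 / \<rho>) \<cdot>\<^sub>m (D_Delta m L p lm lp * (C @\<^sub>r 0\<^sub>m p (n * p))) @\<^sub>c
     (D_Delta m L p lm lp * (0\<^sub>m p p @\<^sub>r 1\<^sub>m p))"

definition U_mat :: "real \<Rightarrow> real \<Rightarrow> nat \<Rightarrow> nat \<Rightarrow> nat \<Rightarrow> nat \<Rightarrow> real mat \<Rightarrow> real \<Rightarrow>
    real mat \<Rightarrow> real mat \<Rightarrow> real mat \<Rightarrow> real mat" where
  "U_mat m L n p lm lp C \<rho> P11 P22 MD =
     (F_mat m L n p lm lp C \<rho>)\<^sup>T * P11 * F_mat m L n p lm lp C \<rho>
     - diag_block_mat [P11, P22, 0\<^sub>m p p]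
     + (K_mat m L n p lm lp C \<rho>)\<^sup>T * MD * K_mat m L n p lm lp C \<rho>"

definition lmi_mat :: "real \<Rightarrow> real \<Rightarrow> nat \<Rightarrow> nat \<Rightarrow> nat \<Rightarrow> nat \<Rightarrow> real mat \<Rightarrow> real \<Rightarrow>
    real mat \<Rightarrow> real mat \<Rightarrow> real mat \<Rightarrow> real mat \<Rightarrow> real mat \<Rightarrow> real mat" where
  "lmi_mat m L n p lm lp C \<rho> P11 P22 QA QB MD =
     (let R = 0\<^sub>m (n * p) (p * (lm + lp)) @\<^sub>c
              ((1 / \<rho>) \<cdot>\<^sub>m QA + (m / \<rho>) \<cdot>\<^sub>m (QB * C)) @\<^sub>c QB
      in four_block_mat (- P22) R (R\<^sup>T) (U_mat m L n p lm lp C \<rho> P11 P22 MD))"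

end

theory Submission
  imports Defs "Jordan_Normal_Form.Determinant"
begin

text \<open>
  Along a trajectory rescaled by \<open>\<rho>\<^sup>-\<^sup>k\<close> the matrix inequality says that
  \<open>V = \<psi>\<^sup>T P\<^sub>1\<^sub>1 \<psi> + x\<^sup>T P\<^sub>2\<^sub>2 x\<close>, with \<open>\<psi>\<close> the filter state, decreases at each step by at least
  the multiplier term; no Schur complement is needed, since the successor state itself is a test vector
  for the first block row. The multiplier term is a sum of products of present and past filter inputs,
  and for gradients of convex functions with Lipschitz gradient its sum over every finite horizon is
  nonnegative when the filter starts at rest. Hence \<open>V\<close> never exceeds its initial value
  \<open>\<xi>\<^sub>0\<^sup>T P\<^sub>2\<^sub>2 \<xi>\<^sub>0\<close>. Although \<open>P\<^sub>1\<^sub>1\<close> is not assumed positive, the inequality for a filter without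
  input forces this, because the filter is nilpotent. So \<open>x\<^sup>T P\<^sub>2\<^sub>2 x\<close> stays bounded, which is the
  claimed decay in the original coordinates.
\<close>

subsection \<open>Functions with a strongly monotone Lipschitz gradient\<close>

text \<open>Write \<open>a\<close> for \<open>(L - m) y - w\<close> and \<open>u\<close> for
  \<open>w\<close>, both rescaled. Young's inequality bounds the product of \<open>a j\<close> and
  \<open>u k\<close> by \<open>(G j + h k) / \<rho> ^ (j + k)\<close> up to a constant factor, with
  equality for \<open>j = k\<close>. Off-diagonal coefficients \<open>c i\<close> are nonpositive
  and reverse the bound, so the weighted sum of products is at least a sum that separates into
  multiples of the \<open>G j\<close> and of the \<open>h k\<close>. Up to positive factors, the
  weight of \<open>G j\<close> is a sum of \<open>c i * \<rho> powi i\<close> and that of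
  \<open>h k\<close> a sum of \<open>c i * \<rho> powi (- i)\<close>, each over a window of indices;
  this is where the two conditions on the multiplier come from. A negative index pairs a past
  \<open>a\<close> with the present \<open>u\<close>, a positive one the present \<open>a\<close>
  with a past \<open>u\<close>. Both are causal, hence a filter made of two delay lines, of length
  \<open>lm\<close> for \<open>a\<close> and \<open>lp\<close> for \<open>u\<close>. All that is
  used of \<open>H\<close> is the pair \<open>G\<close>, \<open>h\<close>, which does not occur in
  the final bound, so the constant is uniform over the class.\<close>

lemma gderiv_lower_quadratic:
  fixes f :: "'a::real_inner \<Rightarrow> real"
  assumes f: "\<And>x. GDERIV f x :> g x"
    and mono: "\<And>x y. \<mu> * (norm (x - y))\<^sup>2 \<le> inner (g x - g y) (x - y)"
  shows "f x + inner (g x) (y - x) + \<mu> / 2 * (norm (y - x))\<^sup>2 \<le> f y"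
proof -
  define d where "d = y - x"
  \<comment> \<open>For \<open>t > 0\<close> the derivative of \<open>h\<close> is
    \<open>1 / t\<close> times the slack of \<open>mono\<close> at the points \<open>x + t d\<close>
    and \<open>x\<close>.\<close>
  define h where "h t = f (x + t *\<^sub>R d) - t * inner (g x) d - \<mu> / 2 * t\<^sup>2 * (norm d)\<^sup>2" for t
  have der: "(h has_real_derivative inner (g (x + t *\<^sub>R d) - g x) d - \<mu> * t * (norm d)\<^sup>2) (at t)" for t
  proof -
    have "((\<lambda>t. f (x + t *\<^sub>R d)) has_derivative (\<lambda>s. inner (s *\<^sub>R d) (g (x + t *\<^sub>R d)))) (at t)"
      by (rule has_derivative_compose[where g = f and f = "\<lambda>t. x + t *\<^sub>R d"])
         (use f in \<open>auto simp: gderiv_def intro!: derivative_eq_intros\<close>)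
    then have "((\<lambda>t. f (x + t *\<^sub>R d)) has_real_derivative inner (g (x + t *\<^sub>R d)) d) (at t)"
      by (rule has_derivative_imp_has_field_derivative) (simp add: inner_commute mult.commute)
    then show ?thesis
      unfolding h_def by (auto intro!: derivative_eq_intros simp: inner_diff_left)
  qed
  have "h 0 \<le> h 1"
  proof (rule DERIV_nonneg_imp_nondecreasing[where f = h])
    fix t :: real assume t: "0 \<le> t" "t \<le> 1"
    have "0 \<le> inner (g (x + t *\<^sub>R d) - g x) d - \<mu> * t * (norm d)\<^sup>2"
    proof (cases "t = 0")
      case False
      have "t * (\<mu> * t * (norm d)\<^sup>2) \<le> t * inner (g (x + t *\<^sub>R d) - g x) d"
        using mono[of "x + t *\<^sub>R d" x] by (simp add: power2_eq_square mult_ac)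
      with t False show ?thesis by simp
    qed simp
    with der show "\<exists>y. DERIV h t :> y \<and> 0 \<le> y" by blast
  qed simp
  then show ?thesis by (simp add: h_def d_def)
qed

text \<open>The point \<open>z = x - t v\<close> with \<open>v = g x - g y\<close> is a gradient
  step. The tangent at \<open>y\<close> bounds \<open>f z\<close> from below, the quadratic at
  \<open>x\<close> from above (\<open>gderiv_lower_quadratic\<close> for \<open>- f\<close> with
  constant \<open>- l\<close>), and \<open>t = 1 / l\<close> is the best step. Keeping the factor
  \<open>l\<close> on the right instead of dividing by it covers \<open>l = 0\<close>, which occurs
  for \<open>m = L\<close>.\<close>

lemma gderiv_interpolation:
  fixes f :: "'a::real_inner \<Rightarrow> real"
  assumes f: "\<And>x. GDERIV f x :> g x"
    and mono: "\<And>x y. 0 \<le> inner (g x - g y) (x - y)"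
    and lip: "\<And>x y. inner (g x - g y) (x - y) \<le> l * (norm (x - y))\<^sup>2"
    and "0 \<le> l"
  shows "(norm (g x - g y))\<^sup>2 / 2 \<le> l * (f x - f y - inner (g y) (x - y))"
proof -
  define v where "v = g x - g y"
  have lower: "f x + inner (g x) (y - x) \<le> f y" for x y
    using gderiv_lower_quadratic[OF f, of 0 x y] mono by simp
  have upper: "f y \<le> f x + inner (g x) (y - x) + l / 2 * (norm (y - x))\<^sup>2" for x y
  proof -
    have "- l * (norm (x - y))\<^sup>2 \<le> inner (- g x - - g y) (x - y)" for x y
      using lip[of x y] by (simp add: inner_diff_left)
    from gderiv_lower_quadratic[OF GDERIV_minus[OF f] this, of x y] show ?thesis by simp
  qed
  have key: "t * (norm v)\<^sup>2 - l / 2 * t\<^sup>2 * (norm v)\<^sup>2 \<le> f x - f y - inner (g y) (x - y)" for t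
  proof -
    define z where "z = x - t *\<^sub>R v"
    have zx: "inner (g x) (z - x) = - t * inner (g x) v" "(norm (z - x))\<^sup>2 = t\<^sup>2 * (norm v)\<^sup>2"
      by (simp_all add: z_def power_mult_distrib)
    have zy: "inner (g y) (z - y) = inner (g y) (x - y) - t * inner (g y) v"
      by (simp add: z_def inner_diff_right)
    have vv: "t * (norm v)\<^sup>2 = t * inner (g x) v - t * inner (g y) v"
      by (simp add: power2_norm_eq_inner v_def inner_diff_left algebra_simps)
    show ?thesis
      using lower[of y z] upper[of z x] unfolding zx zy vv by (simp add: mult.assoc)
  qed
  show ?thesis
  proof (cases "l = 0")
    case True
    have "(norm v)\<^sup>2 \<le> f x - f y - inner (g y) (x - y)" using key[of 1] True by simp
    also have "\<dots> \<le> 0" using upper[of x y] True by simp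
    finally have "(norm v)\<^sup>2 \<le> 0" .
    with True show ?thesis by (simp add: v_def)
  next
    case False
    with \<open>0 \<le> l\<close> have "l > 0" by simp
    have "(norm v)\<^sup>2 / 2 = l * ((1 / l) * (norm v)\<^sup>2 - l / 2 * (1 / l)\<^sup>2 * (norm v)\<^sup>2)"
      using \<open>l > 0\<close> by (simp add: field_simps power2_eq_square)
    also have "\<dots> \<le> l * (f x - f y - inner (g y) (x - y))"
      using key[of "1 / l"] \<open>l > 0\<close> by (intro mult_left_mono) simp_all
    finally show ?thesis by (simp add: v_def)
  qed
qed

text \<open>Up to constants, \<open>G\<close> and \<open>h\<close> are the two conjugate convex functions of Young's inequality.\<close>

lemma zames_falb_pair:
  fixes f :: "'a::real_inner \<Rightarrow> real"
  assumes f: "\<And>x. GDERIV f x :> g x"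
    and mono: "\<And>x y. 0 \<le> inner (g x - g y) (x - y)"
    and lip: "\<And>x y. inner (g x - g y) (x - y) \<le> l * (norm (x - y))\<^sup>2"
    and "0 \<le> l" and g0: "g 0 = 0"
  obtains G h :: "'a \<Rightarrow> real" where
    "\<And>x. 0 \<le> G x" "\<And>x. 0 \<le> h x"
    "\<And>x. inner (l *\<^sub>R x - g x) (g x) = G x + h x"
    "\<And>x y. inner (l *\<^sub>R x - g x) (g y) \<le> G x + h y"
proof -
  note ip = gderiv_interpolation[OF f mono lip \<open>0 \<le> l\<close>]
  \<comment> \<open>Expanding, \<open>h y = l * (inner y (g y) - f y + f 0) - (norm (g y))\<^sup>2 /
    2\<close>, so \<open>G x + h y - inner (l *\<^sub>R x - g x) (g y)\<close> is exactly the slack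
    of \<open>ip\<close> at \<open>x\<close>, \<open>y\<close>. The signs of \<open>G\<close> and
    \<open>h\<close> are the cases where one of the two points is 0.\<close>
  define G where "G x = l * (f x - f 0) - (norm (g x))\<^sup>2 / 2" for x
  define h where "h x = inner (l *\<^sub>R x - g x) (g x) - G x" for x
  show ?thesis
  proof
    fix x
    show "0 \<le> G x" using ip[of x 0] by (simp add: G_def g0)
    show "0 \<le> h x" using ip[of 0 x]
      by (simp add: h_def G_def g0 inner_diff_left power2_norm_eq_inner inner_commute algebra_simps)
    show "inner (l *\<^sub>R x - g x) (g x) = G x + h x" by (simp add: h_def)
    fix y
    show "inner (l *\<^sub>R x - g x) (g y) \<le> G x + h y"
      using ip[of x y]
      by (simp add: h_def G_def inner_diff_left inner_diff_right power2_norm_eq_inner inner_commute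
          field_simps)
  qed
qed

text \<open>The Riesz vector of the derivative exists and is unique, which makes the definite
  description in \<open>gradient\<close> meaningful.\<close>

lemma gderiv_gradient:
  assumes "H differentiable (at x)"
  shows "GDERIV H x :> gradient H x"
proof -
  from assms obtain D where D: "(H has_derivative D) (at x)" by (auto simp: differentiable_def)
  then interpret linear D by (rule has_derivative_linear)
  define g where "g = (\<Sum>b\<in>Basis. D b *\<^sub>R b)"
  have "D h = inner h g" for h
  proof -
    have "D h = D (\<Sum>b\<in>Basis. inner h b *\<^sub>R b)" by (simp add: euclidean_representation)
    also have "\<dots> = inner h g" by (simp add: sum scale g_def inner_sum_right mult.commute)
    finally show ?thesis .
  qed
  then have *: "D = (\<lambda>h. inner h g)" by blast
  have "GDERIV H x :> g" using D unfolding gderiv_def * .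
  moreover have "g' = g" if "GDERIV H x :> g'" for g'
  proof -
    have "(\<lambda>h. inner h g') = D" using that D unfolding gderiv_def by (rule has_derivative_unique)
    then have "inner (g' - g) (g' - g) = 0" by (metis * inner_diff_right diff_self)
    then show ?thesis by simp
  qed
  ultimately show ?thesis unfolding gradient_def by (rule theI)
qed

section \<open>The class S(m, L): its minimizer and its conjugate pair\<close>

context
  fixes m L :: real and H :: "real^'p::finite \<Rightarrow> real"
  assumes m: "0 < m" and H: "H \<in> S_class m L"
begin

lemma S_class_gderiv: "GDERIV H x :> gradient H x"
  using H by (intro gderiv_gradient) (auto simp: S_class_def twice_cont_diff_def)

lemma S_class_mono: "m * (norm (x - y))\<^sup>2 \<le> inner (gradient H x - gradient H y) (x - y)"
  using H by (auto simp: S_class_def)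

lemma S_class_lip: "inner (gradient H x - gradient H y) (x - y) \<le> L * (norm (x - y))\<^sup>2"
proof -
  have "inner (gradient H x - gradient H y) (x - y) \<le> norm (gradient H x - gradient H y) * norm (x - y)"
    by (rule norm_cauchy_schwarz)
  also have "\<dots> \<le> (L * norm (x - y)) * norm (x - y)"
    using H by (intro mult_right_mono) (auto simp: S_class_def)
  finally show ?thesis by (simp add: power2_eq_square mult_ac)
qed

text \<open>\<open>arg_min\<close> says nothing until a minimum is known to exist. Beyond radius
  \<open>R\<close> the quadratic \<open>m / 2 * (norm y)\<^sup>2\<close> outweighs the linear term
  of the lower bound at 0, so \<open>H\<close> is at least \<open>H 0\<close> there, and a minimum
  over the compact ball is global.\<close>

lemma S_class_minimizer: "H (minimizer H) \<le> H x"
proof -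
  have cont: "continuous_on UNIV H"
    using S_class_gderiv by (auto intro!: has_derivative_continuous_on simp: gderiv_def has_derivative_at_withinI)
  define R where "R = 2 * norm (gradient H 0) / m"
  have R: "0 \<le> R" using m by (simp add: R_def)
  have far: "H 0 \<le> H y" if "R \<le> norm y" for y
  proof -
    have "norm (gradient H 0) \<le> m / 2 * norm y" using that m by (simp add: R_def field_simps)
    then have "norm (gradient H 0) * norm y \<le> m / 2 * norm y * norm y" by (rule mult_right_mono) simp
    moreover have "- inner (gradient H 0) y \<le> norm (gradient H 0) * norm y"
      using norm_cauchy_schwarz[of "- gradient H 0" y] by simp
    ultimately show ?thesis
      using gderiv_lower_quadratic[OF S_class_gderiv S_class_mono, of 0 y]
      by (simp add: power2_eq_square)
  qed
  have "\<exists>z\<in>cball 0 R. \<forall>y\<in>cball 0 R. H z \<le> H y"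
    using R continuous_on_subset[OF cont] by (intro continuous_attains_inf) auto
  then obtain z where z: "\<And>y. y \<in> cball 0 R \<Longrightarrow> H z \<le> H y" by blast
  have "H z \<le> H y" for y
    using z[of 0] z[of y] far[of y] R by (cases "norm y \<le> R") auto
  then show ?thesis
    unfolding minimizer_def
    by (intro arg_minI[where Q = "\<lambda>z. H z \<le> H x"]) (auto simp: not_less)
qed

lemma S_class_gradient_minimizer: "gradient H (minimizer H) = 0"
proof -
  have "(\<lambda>h. inner h (gradient H (minimizer H))) = (\<lambda>h. 0)"
    using S_class_gderiv[of "minimizer H"]
    by (intro differential_zero_maxmin[where S = UNIV and x = "minimizer H" and f = H])
       (auto simp: S_class_minimizer gderiv_def)
  then show ?thesis by (metis inner_eq_zero_iff)
qed

text \<open>Centring at the minimizer yields \<open>g 0 = 0\<close>, and subtracting the gradient of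
  \<open>m / 2 * inner x x\<close> lowers both constants by \<open>m\<close>, leaving a monotone map
  with upper constant \<open>L - m\<close>. This \<open>g\<close> is the pointwise map behind
  \<open>Delta\<close>.\<close>

lemma S_class_zames_falb:
  defines "g \<equiv> \<lambda>x. gradient H (x + minimizer H) - m *\<^sub>R x"
  assumes "m \<le> L"
  obtains G h :: "real^'p \<Rightarrow> real" where
    "\<And>x. 0 \<le> G x" "\<And>x. 0 \<le> h x"
    "\<And>x. inner ((L - m) *\<^sub>R x - g x) (g x) = G x + h x"
    "\<And>x y. inner ((L - m) *\<^sub>R x - g x) (g y) \<le> G x + h y"
proof (rule zames_falb_pair[where g = g and l = "L - m"])
  fix x y
  have eq: "inner (g x - g y) (x - y) =
      inner (gradient H (x + minimizer H) - gradient H (y + minimizer H)) (x - y) - m * (norm (x - y))\<^sup>2"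
    by (simp add: g_def algebra_simps inner_diff_left inner_diff_right power2_norm_eq_inner)
  show "0 \<le> inner (g x - g y) (x - y)"
    using S_class_mono[of "x + minimizer H" "y + minimizer H"] by (simp add: eq)
  show "inner (g x - g y) (x - y) \<le> (L - m) * (norm (x - y))\<^sup>2"
    using S_class_lip[of "x + minimizer H" "y + minimizer H"] by (simp add: eq left_diff_distrib)
next
  fix x
  have "((\<lambda>x. H (x + minimizer H)) has_derivative
      (\<lambda>h. inner h (gradient H (x + minimizer H)))) (at x)"
    by (rule has_derivative_compose[where g = H and f = "\<lambda>x. x + minimizer H"])
       (use S_class_gderiv in \<open>auto simp: gderiv_def intro!: derivative_eq_intros\<close>)
  then show "GDERIV (\<lambda>x. H (x + minimizer H) - m / 2 * inner x x) x :> g x"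
    unfolding gderiv_def g_def
    by (auto intro!: derivative_eq_intros simp: inner_diff_right inner_commute)
qed (use assms S_class_gradient_minimizer in \<open>auto simp: g_def\<close>)

end

subsection \<open>Products of block matrices and block vectors\<close>

lemma scalar_prod_append_dim:
  "dim_vec v = dim_vec v' \<Longrightarrow> dim_vec w = dim_vec w' \<Longrightarrow>
    scalar_prod (v @\<^sub>v w) (v' @\<^sub>v w') = scalar_prod v v' + scalar_prod w w'"
  by (rule scalar_prod_append) (auto intro: carrier_vecI)

lemma append_vec_add_dim:
  "dim_vec v = dim_vec v' \<Longrightarrow> dim_vec w = dim_vec w' \<Longrightarrow>
    (v @\<^sub>v w) + (v' @\<^sub>v w') = (v + v') @\<^sub>v (w + w')" for v :: "real Matrix.vec"
  by (intro eq_vecI) auto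

lemma append_vec_assoc: "(u @\<^sub>v v) @\<^sub>v w = u @\<^sub>v v @\<^sub>v w"
  by (intro eq_vecI) auto

lemma dim_append_cols [simp]:
  "dim_row (X @\<^sub>c Y) = dim_row X" "dim_col (X @\<^sub>c Y) = dim_col X + dim_col Y"
  by (auto simp: append_cols_def)

lemma dim_append_rows [simp]:
  "dim_row (X @\<^sub>r Y) = dim_row X + dim_row Y" "dim_col (X @\<^sub>r Y) = dim_col X"
  by (auto simp: append_rows_def)

lemma index_append_cols:
  "dim_row Y = dim_row X \<Longrightarrow> i < dim_row X \<Longrightarrow> j < dim_col X + dim_col Y \<Longrightarrow>
    (X @\<^sub>c Y) $$ (i, j) = (if j < dim_col X then X $$ (i, j) else Y $$ (i, j - dim_col X))"
  by (auto simp: append_cols_def)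

lemma append_cols_mult_vec:
  assumes "dim_row Y = dim_row X" "dim_vec v = dim_col X" "dim_vec w = dim_col Y"
  shows "(X @\<^sub>c Y) *\<^sub>v (v @\<^sub>v w) = X *\<^sub>v v + Y *\<^sub>v w"
proof (rule eq_vecI)
  fix i assume "i < dim_vec (X *\<^sub>v v + Y *\<^sub>v w)"
  then have i: "i < dim_row X" "i < dim_row Y" using assms by auto
  have "row (X @\<^sub>c Y) i = row X i @\<^sub>v row Y i"
    using i assms(1) by (intro eq_vecI) (auto simp: index_append_cols)
  with i assms show "((X @\<^sub>c Y) *\<^sub>v (v @\<^sub>v w)) $ i = (X *\<^sub>v v + Y *\<^sub>v w) $ i"
    by (simp add: scalar_prod_append_dim)
qed (use assms in auto)

lemma append_rows_mult_vec:
  "dim_col X = dim_vec v \<Longrightarrow> dim_col Y = dim_vec v \<Longrightarrow> (X @\<^sub>r Y) *\<^sub>v v = X *\<^sub>v v @\<^sub>v Y *\<^sub>v v"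
  by (rule mat_mult_append[of _ "dim_row X" "dim_vec v" _ "dim_row Y"]) (auto intro: carrier_matI)

lemma zero_mat_mult_vec: "dim_vec v = nc \<Longrightarrow> 0\<^sub>m nr nc *\<^sub>v v = 0\<^sub>v nr"
  by (intro eq_vecI) (auto simp: scalar_prod_def)

lemma mult_mat_zero_vec [simp]: "dim_col X = c \<Longrightarrow> X *\<^sub>v 0\<^sub>v c = 0\<^sub>v (dim_row X)" for X :: "real mat"
  by (intro eq_vecI) auto

lemma one_mat_mult_vec: "dim_vec v = n \<Longrightarrow> 1\<^sub>m n *\<^sub>v v = v" for v :: "real Matrix.vec"
  by (rule one_mult_mat_vec) (auto intro: carrier_vecI)

lemma add_zero_vec_dim [simp]:
  "dim_vec v = n \<Longrightarrow> v + 0\<^sub>v n = v" "dim_vec v = n \<Longrightarrow> 0\<^sub>v n + v = v" for v :: "real Matrix.vec"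
  by (auto intro!: eq_vecI)

lemma smult_mat_mult_vec: "dim_vec v = dim_col X \<Longrightarrow> (k \<cdot>\<^sub>m X) *\<^sub>v v = k \<cdot>\<^sub>v (X *\<^sub>v v)"
  for X :: "real mat"
  by (intro eq_vecI) (auto simp: scalar_prod_def sum_distrib_left mult_ac)

lemma mult_mat_mult_vec:
  "dim_col X = dim_row Y \<Longrightarrow> dim_vec v = dim_col Y \<Longrightarrow> (X * Y) *\<^sub>v v = X *\<^sub>v (Y *\<^sub>v v)"
  for X Y :: "real mat"
  by (rule assoc_mult_mat_vec) (auto intro: carrier_matI carrier_vecI)

lemma four_block_mat_mult_vec_dim:
  assumes "dim_row Y = dim_row X" "dim_col Z = dim_col X" "dim_row Z = dim_row W" "dim_col Y = dim_col W"
    "dim_vec v = dim_col X" "dim_vec w = dim_col W"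
  shows "four_block_mat X Y Z W *\<^sub>v (v @\<^sub>v w) = (X *\<^sub>v v + Y *\<^sub>v w) @\<^sub>v (Z *\<^sub>v v + W *\<^sub>v w)"
  using assms by (intro four_block_mat_mult_vec) (auto intro: carrier_matI carrier_vecI)

lemma diag_block_mat_Cons_mult_vec:
  fixes X :: "real mat"
  assumes "dim_vec v = dim_col X" "dim_vec w = sum_list (map dim_col Xs)"
  shows "diag_block_mat (X # Xs) *\<^sub>v (v @\<^sub>v w) = X *\<^sub>v v @\<^sub>v diag_block_mat Xs *\<^sub>v w"
  using assms
  by (simp add: Let_def four_block_mat_mult_vec_dim dim_diag_block_mat zero_mat_mult_vec)

lemma diag_block_mat_Nil_mult_vec: "dim_vec v = 0 \<Longrightarrow> diag_block_mat [] *\<^sub>v v = (0\<^sub>v 0 :: real Matrix.vec)"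
  by (intro eq_vecI) auto

lemma append_zero_vec_Nil [simp]: "v @\<^sub>v 0\<^sub>v 0 = v"
  by (intro eq_vecI) auto

lemma diag_block_mat_single_mult_vec:
  "dim_vec v = dim_col X \<Longrightarrow> diag_block_mat [X] *\<^sub>v v = X *\<^sub>v v" for X :: "real mat"
  using diag_block_mat_Cons_mult_vec[of v X "0\<^sub>v 0" "[]"]
  by (simp add: diag_block_mat_Nil_mult_vec del: diag_block_mat.simps)

lemmas block_mult_simps =
  append_cols_mult_vec append_rows_mult_vec zero_mat_mult_vec one_mat_mult_vec smult_mat_mult_vec
  mult_mat_mult_vec four_block_mat_mult_vec_dim diag_block_mat_Cons_mult_vec
  diag_block_mat_single_mult_vec

lemma quadratic_form_congruence:
  fixes X P :: "real mat"
  assumes X: "X \<in> carrier_mat r c" and P: "P \<in> carrier_mat r r" and s: "s \<in> carrier_vec c"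
  shows "scalar_prod s ((X\<^sup>T * P * X) *\<^sub>v s) = scalar_prod (X *\<^sub>v s) (P *\<^sub>v (X *\<^sub>v s))"
proof -
  have Xs: "P *\<^sub>v (X *\<^sub>v s) \<in> carrier_vec r" using assms by auto
  have "scalar_prod s ((X\<^sup>T * P * X) *\<^sub>v s) = scalar_prod s (X\<^sup>T *\<^sub>v (P *\<^sub>v (X *\<^sub>v s)))"
    using assms by (simp add: mult_mat_mult_vec)
  also have "\<dots> = scalar_prod (X\<^sup>T *\<^sub>v (P *\<^sub>v (X *\<^sub>v s))) s"
    using X s Xs by (intro comm_scalar_prod) auto
  also have "\<dots> = scalar_prod (P *\<^sub>v (X *\<^sub>v s)) (X *\<^sub>v s)"
    using transpose_vec_mult_scalar[OF X s Xs] .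
  also have "\<dots> = scalar_prod (X *\<^sub>v s) (P *\<^sub>v (X *\<^sub>v s))"
    using X s Xs by (intro comm_scalar_prod) auto
  finally show ?thesis .
qed

section \<open>Stacked block vectors and Kronecker products with an identity\<close>

definition block_vec :: "nat \<Rightarrow> nat \<Rightarrow> (nat \<Rightarrow> nat \<Rightarrow> real) \<Rightarrow> real Matrix.vec" where
  "block_vec p l f = Matrix.vec (l * p) (\<lambda>i. f (i div p) (i mod p))"

lemma block_vec_carrier [simp]: "block_vec p l f \<in> carrier_vec (l * p)"
  and dim_block_vec [simp]: "dim_vec (block_vec p l f) = l * p"
  by (simp_all add: block_vec_def)

lemma block_index:
  fixes i l p :: nat
  assumes "i < l * p" shows "i div p < l" "i mod p < p" "0 < p"
proof -
  show "0 < p" using assms by (cases "p = 0") auto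
  then show "i mod p < p" by simp
  show "i div p < l" using assms by (simp add: less_mult_imp_div_less)
qed

lemma block_vec_cong:
  "(\<And>i e. i < l \<Longrightarrow> e < p \<Longrightarrow> f i e = g i e) \<Longrightarrow> block_vec p l f = block_vec p l g"
  unfolding block_vec_def by (intro eq_vecI) (auto dest: block_index)

lemma block_vec_of_vec: "v \<in> carrier_vec (l * p) \<Longrightarrow> v = block_vec p l (\<lambda>i e. v $ (i * p + e))"
  unfolding block_vec_def by (intro eq_vecI) auto

lemma block_vec_of_single: "v \<in> carrier_vec p \<Longrightarrow> v = block_vec p 1 (\<lambda>_ e. v $ e)"
  unfolding block_vec_def by (intro eq_vecI) auto

lemma block_vec_append:
  "block_vec p l f @\<^sub>v block_vec p r g = block_vec p (l + r) (\<lambda>i. if i < l then f i else g (i - l))"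
proof (intro eq_vecI)
  fix i assume "i < dim_vec (block_vec p (l + r) (\<lambda>i. if i < l then f i else g (i - l)))"
  then have i: "i < (l + r) * p" by simp
  then have p: "0 < p" by (rule block_index)
  show "(block_vec p l f @\<^sub>v block_vec p r g) $ i =
      block_vec p (l + r) (\<lambda>i. if i < l then f i else g (i - l)) $ i"
  proof (cases "i < l * p")
    case True
    then show ?thesis using i by (simp add: block_vec_def block_index)
  next
    case False
    then obtain k where k: "i = l * p + k" by (metis le_iff_add not_less)
    with i p show ?thesis by (simp add: block_vec_def algebra_simps)
  qed
qed (simp add: algebra_simps)

lemma sum_div_mod:
  fixes F :: "nat \<Rightarrow> nat \<Rightarrow> real"
  shows "(\<Sum>k<c * p. F (k div p) (k mod p)) = (\<Sum>j<c. \<Sum>e<p. F j e)"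
proof (induction c)
  case (Suc c)
  have "(\<Sum>k<Suc c * p. F (k div p) (k mod p)) =
      (\<Sum>k<c * p. F (k div p) (k mod p)) + (\<Sum>k=c * p..<c * p + p. F (k div p) (k mod p))"
    by (subst sum.union_disjoint[symmetric]) (auto intro!: sum.cong)
  also have "(\<Sum>k=c * p..<c * p + p. F (k div p) (k mod p)) = (\<Sum>e<p. F c e)"
    using sum.shift_bounds_nat_ivl[of "\<lambda>k. F (k div p) (k mod p)" 0 "c * p" p]
    by (simp add: atLeast0LessThan add.commute)
  finally show ?case using Suc by simp
qed simp

lemma scalar_prod_block_vec:
  "scalar_prod (block_vec p l f) (block_vec p l g) = (\<Sum>j<l. \<Sum>e<p. f j e * g j e)"
  using sum_div_mod[of "\<lambda>j e. f j e * g j e" p l]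
  by (simp add: scalar_prod_def block_vec_def atLeast0LessThan)

lemma kron_one_dim [simp]:
  "dim_row (X \<otimes>\<^sub>m 1\<^sub>m p) = dim_row X * p" "dim_col (X \<otimes>\<^sub>m 1\<^sub>m p) = dim_col X * p"
  by (simp_all add: kron_def)

text \<open>The identity factor keeps the entry number inside a block fixed, so only block numbers
  are mixed. The filter matrices of this form are therefore computed through their small left
  factors.\<close>

lemma kron_one_mult_block_vec:
  assumes "dim_col X = c"
  shows "(X \<otimes>\<^sub>m 1\<^sub>m p) *\<^sub>v block_vec p c f = block_vec p (dim_row X) (\<lambda>i e. \<Sum>j<c. X $$ (i, j) * f j e)"
proof (rule eq_vecI)
  fix i assume "i < dim_vec (block_vec p (dim_row X) (\<lambda>i e. \<Sum>j<c. X $$ (i, j) * f j e))"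
  then have i: "i < dim_row X * p" by simp
  have "((X \<otimes>\<^sub>m 1\<^sub>m p) *\<^sub>v block_vec p c f) $ i =
      (\<Sum>k<c * p. X $$ (i div p, k div p) * 1\<^sub>m p $$ (i mod p, k mod p) * f (k div p) (k mod p))"
    using i assms by (simp add: scalar_prod_def kron_def block_vec_def atLeast0LessThan)
  also have "\<dots> = (\<Sum>j<c. \<Sum>e<p. X $$ (i div p, j) * 1\<^sub>m p $$ (i mod p, e) * f j e)"
    using sum_div_mod[of "\<lambda>j e. X $$ (i div p, j) * 1\<^sub>m p $$ (i mod p, e) * f j e" p c] by simp
  also have "\<dots> = (\<Sum>j<c. \<Sum>e<p. if e = i mod p then X $$ (i div p, j) * f j (i mod p) else 0)"
    using block_index[OF i] by (intro sum.cong) auto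
  also have "\<dots> = (\<Sum>j<c. X $$ (i div p, j) * f j (i mod p))"
    using block_index[OF i] by (simp add: sum.delta)
  finally show "((X \<otimes>\<^sub>m 1\<^sub>m p) *\<^sub>v block_vec p c f) $ i =
      block_vec p (dim_row X) (\<lambda>i e. \<Sum>j<c. X $$ (i, j) * f j e) $ i"
    using i by (simp add: block_vec_def)
qed simp

text \<open>Brings the folded block row of \<open>multiplier_set\<close> into Kronecker form, from
  which single entries can be read off.\<close>

lemma foldr_append_cols_scalar_blocks:
  assumes "0 < p" and "\<And>i. i \<in> set is \<Longrightarrow> M i = c i \<cdot>\<^sub>m 1\<^sub>m p"
  shows "foldr (@\<^sub>c) (map M is) (0\<^sub>m p 0) = Matrix.mat 1 (length is) (\<lambda>(_, j). c (is ! j)) \<otimes>\<^sub>m 1\<^sub>m p"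
  using assms(2)
proof (induction "is")
  case (Cons a "is")
  show ?case
  proof (intro eq_matI)
    fix i j
    assume "i < dim_row (Matrix.mat 1 (length (a # is)) (\<lambda>(_, j). c ((a # is) ! j)) \<otimes>\<^sub>m 1\<^sub>m p)"
      and "j < dim_col (Matrix.mat 1 (length (a # is)) (\<lambda>(_, j). c ((a # is) ! j)) \<otimes>\<^sub>m 1\<^sub>m p)"
    then have ij: "i < p" "j < p + length is * p" by simp_all
    show "foldr (@\<^sub>c) (map M (a # is)) (0\<^sub>m p 0) $$ (i, j) =
        (Matrix.mat 1 (length (a # is)) (\<lambda>(_, j). c ((a # is) ! j)) \<otimes>\<^sub>m 1\<^sub>m p) $$ (i, j)"
    proof (cases "j < p")
      case True
      then show ?thesis using ij Cons by (simp add: index_append_cols kron_def)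
    next
      case False
      then obtain k where k: "j = p + k" by (metis le_iff_add not_less)
      then have "k div p < length is" "k mod p < p" using ij by (auto intro: block_index)
      then show ?thesis using ij Cons \<open>0 < p\<close> by (simp add: index_append_cols kron_def k)
    qed
  qed (use Cons in auto)
qed (auto intro!: eq_matI)

subsection \<open>The filter and the multiplier\<close>

lemma A_Delta_mult_block_vec:
  "A_Delta p lm lp *\<^sub>v (block_vec p lm f @\<^sub>v block_vec p lp g) =
    block_vec p lm (\<lambda>i e. if Suc i < lm then f (Suc i) e else 0) @\<^sub>v
    block_vec p lp (\<lambda>i e. if Suc i < lp then g (Suc i) e else 0)"
proof -
  have "A_Delta p lm lp *\<^sub>v (block_vec p lm f @\<^sub>v block_vec p lp g) =
      block_vec p (lm + lp) (\<lambda>i e. \<Sum>j<lm + lp. diag_block_mat [shift_mat lm, shift_mat lp] $$ (i, j) *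
        (if j < lm then f j else g (j - lm)) e)"
    by (simp add: A_Delta_def block_vec_append kron_one_mult_block_vec dim_diag_block_mat shift_mat_def
        del: diag_block_mat.simps)
  also have "\<dots> = block_vec p (lm + lp) (\<lambda>i. if i < lm
      then (\<lambda>e. if Suc i < lm then f (Suc i) e else 0)
      else (\<lambda>e. if Suc (i - lm) < lp then g (Suc (i - lm)) e else 0))"
  proof (rule block_vec_cong)
    fix i e assume i: "i < lm + lp"
    \<comment> \<open>The boundary row \<open>i = lm - 1\<close> matters: its column
      \<open>Suc i\<close> already belongs to the second line, where the off-diagonal block is zero,
      so nothing leaks from one line into the other.\<close>
    have "(\<Sum>j<lm + lp. diag_block_mat [shift_mat lm, shift_mat lp] $$ (i, j) *
        (if j < lm then f j else g (j - lm)) e) =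
      (\<Sum>j<lm + lp. if j = Suc i then (if i < lm then if Suc i < lm then f (Suc i) e else 0
          else g (Suc i - lm) e) else 0)"
      using i by (intro sum.cong) (auto simp: Let_def shift_mat_def Suc_diff_le)
    also have "\<dots> = (if i < lm
      then (\<lambda>e. if Suc i < lm then f (Suc i) e else 0)
      else (\<lambda>e. if Suc (i - lm) < lp then g (Suc (i - lm)) e else 0)) e"
      using i by (auto simp: sum.delta Suc_diff_le)
    finally show "(\<Sum>j<lm + lp. diag_block_mat [shift_mat lm, shift_mat lp] $$ (i, j) *
        (if j < lm then f j else g (j - lm)) e) = (if i < lm
      then (\<lambda>e. if Suc i < lm then f (Suc i) e else 0)
      else (\<lambda>e. if Suc (i - lm) < lp then g (Suc (i - lm)) e else 0)) e" .
  qed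
  finally show ?thesis by (simp add: block_vec_append)
qed

lemma last_unit_col_mult:
  "dim_vec v = p \<Longrightarrow> (last_unit_col l \<otimes>\<^sub>m 1\<^sub>m p) *\<^sub>v v = block_vec p l (\<lambda>i e. if Suc i = l then v $ e else 0)"
  by (subst block_vec_of_single[of v p])
     (auto intro: carrier_vecI block_vec_cong
       simp del: One_nat_def simp: kron_one_mult_block_vec last_unit_col_def)

text \<open>Both lines store their oldest value first. This matches the order of the coefficients in
  \<open>M_-\<close>, from index \<open>- lm\<close> to \<open>-1\<close>, whereas those in
  \<open>M_+\<close> start with the shortest lag; the second line must therefore be read
  backwards.\<close>

lemma exchange_mat_mult_block_vec:
  "(exchange_mat l \<otimes>\<^sub>m 1\<^sub>m p) *\<^sub>v block_vec p l f = block_vec p l (\<lambda>i. f (l - Suc i))"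
proof -
  have "(\<Sum>j<l. exchange_mat l $$ (i, j) * f j e) = f (l - Suc i) e" if "i < l" for i e
  proof -
    have "(\<Sum>j<l. exchange_mat l $$ (i, j) * f j e) = (\<Sum>j<l. if j = l - Suc i then f j e else 0)"
      using that by (intro sum.cong) (auto simp: exchange_mat_def)
    then show ?thesis using that by (simp add: sum.delta)
  qed
  then show ?thesis
    by (subst kron_one_mult_block_vec) (auto simp: exchange_mat_def intro: block_vec_cong)
qed

lemma dim_exchange_mat [simp]: "dim_row (exchange_mat l) = l" "dim_col (exchange_mat l) = l"
  by (simp_all add: exchange_mat_def)

text \<open>For \<open>y = x\<close> and \<open>w = g x\<close> the two outputs are the two factors
  of the products bounded in \<open>zames_falb_pair\<close>, with \<open>l = L - m\<close>.\<close>

lemma W_hat_mult: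
  "dim_vec y = p \<Longrightarrow> dim_vec w = p \<Longrightarrow> W_hat m L p *\<^sub>v (y @\<^sub>v w) = ((L - m) \<cdot>\<^sub>v y - w) @\<^sub>v w"
  unfolding W_hat_def
  by (simp add: block_mult_simps) (auto intro!: eq_vecI)

lemma dim_W_hat [simp]: "dim_row (W_hat m L p) = p + p" "dim_col (W_hat m L p) = p + p"
  by (simp_all add: W_hat_def)

lemma dim_filter [simp]:
  "dim_row (A_Delta p lm lp) = (lm + lp) * p" "dim_col (A_Delta p lm lp) = (lm + lp) * p"
  "dim_row (B_Delta m L p lm lp) = (lm + lp) * p" "dim_col (B_Delta m L p lm lp) = p + p"
  "dim_row (C_Delta p lm lp) = p + (p + (lm * p + (p + (p + lp * p))))"
  "dim_col (C_Delta p lm lp) = (lm + lp) * p"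
  "dim_row (D_Delta m L p lm lp) = p + (p + (lm * p + (p + (p + lp * p))))"
  "dim_col (D_Delta m L p lm lp) = p + p"
  by (simp_all add: A_Delta_def B_Delta_def C_Delta_def D_Delta_def dim_diag_block_mat shift_mat_def
      last_unit_col_def exchange_mat_def algebra_simps del: diag_block_mat.simps)

lemma B_Delta_mult:
  assumes "dim_vec y = p" "dim_vec w = p"
  shows "B_Delta m L p lm lp *\<^sub>v (y @\<^sub>v w) =
    block_vec p lm (\<lambda>i e. if Suc i = lm then ((L - m) \<cdot>\<^sub>v y - w) $ e else 0) @\<^sub>v
    block_vec p lp (\<lambda>i e. if Suc i = lp then w $ e else 0)"
  using assms unfolding B_Delta_def
  by (simp add: mult_mat_mult_vec dim_diag_block_mat last_unit_col_def W_hat_mult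
      flip: last_unit_col_mult del: diag_block_mat.simps)
     (simp add: block_mult_simps last_unit_col_def del: diag_block_mat.simps)

lemma C_Delta_mult:
  "C_Delta p lm lp *\<^sub>v (block_vec p lm f @\<^sub>v block_vec p lp g) =
    0\<^sub>v p @\<^sub>v 0\<^sub>v p @\<^sub>v block_vec p lm f @\<^sub>v 0\<^sub>v p @\<^sub>v 0\<^sub>v p @\<^sub>v block_vec p lp (\<lambda>i. g (lp - Suc i))"
  unfolding C_Delta_def
  by (simp add: block_mult_simps exchange_mat_mult_block_vec)

lemma D_Delta_mult:
  fixes m L :: real
  assumes "dim_vec y = p" "dim_vec w = p"
  defines "a \<equiv> (L - m) \<cdot>\<^sub>v y - w"
  shows "D_Delta m L p lm lp *\<^sub>v (y @\<^sub>v w) = a @\<^sub>v w @\<^sub>v 0\<^sub>v (lm * p) @\<^sub>v w @\<^sub>v a @\<^sub>v 0\<^sub>v (lp * p)"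
  using assms unfolding D_Delta_def
  by (simp add: block_mult_simps W_hat_mult)

text \<open>The columns of \<open>F\<close> and \<open>K\<close> that act on the plant feed the filter with
  \<open>(y, w) = (\<rho>\<^sup>-\<^sup>1 C x, u)\<close>.\<close>

lemma input_split_mult:
  fixes X C :: "real mat"
  assumes "dim_col X = p + p" "C \<in> carrier_mat p (n * p)" "x \<in> carrier_vec (n * p)" "u \<in> carrier_vec p"
  shows "((1 / \<rho>) \<cdot>\<^sub>m (X * (C @\<^sub>r 0\<^sub>m p (n * p))) @\<^sub>c (X * (0\<^sub>m p p @\<^sub>r 1\<^sub>m p))) *\<^sub>v (x @\<^sub>v u) =
    X *\<^sub>v (((1 / \<rho>) \<cdot>\<^sub>v (C *\<^sub>v x)) @\<^sub>v u)"
proof -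
  have "((1 / \<rho>) \<cdot>\<^sub>m (X * (C @\<^sub>r 0\<^sub>m p (n * p))) @\<^sub>c (X * (0\<^sub>m p p @\<^sub>r 1\<^sub>m p))) *\<^sub>v (x @\<^sub>v u) =
      (1 / \<rho>) \<cdot>\<^sub>v (X *\<^sub>v (C *\<^sub>v x @\<^sub>v 0\<^sub>v p)) + X *\<^sub>v (0\<^sub>v p @\<^sub>v u)"
    using assms by (simp add: block_mult_simps)
  also have "\<dots> = X *\<^sub>v ((1 / \<rho>) \<cdot>\<^sub>v (C *\<^sub>v x @\<^sub>v 0\<^sub>v p)) + X *\<^sub>v (0\<^sub>v p @\<^sub>v u)"
    using assms by (subst mult_mat_vec[of _ "dim_row X" "p + p"]) (auto intro!: carrier_matI carrier_vecI)
  also have "\<dots> = X *\<^sub>v ((1 / \<rho>) \<cdot>\<^sub>v (C *\<^sub>v x @\<^sub>v 0\<^sub>v p) + (0\<^sub>v p @\<^sub>v u))"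
    using assms
    by (subst mult_add_distrib_mat_vec[of _ "dim_row X" "p + p"]) (auto intro!: carrier_matI carrier_vecI)
  also have "(1 / \<rho>) \<cdot>\<^sub>v (C *\<^sub>v x @\<^sub>v 0\<^sub>v p) + (0\<^sub>v p @\<^sub>v u) = ((1 / \<rho>) \<cdot>\<^sub>v (C *\<^sub>v x)) @\<^sub>v u"
    using assms by (intro eq_vecI) auto
  finally show ?thesis .
qed

lemma dim_F_K [simp]:
  assumes "C \<in> carrier_mat p (n * p)"
  shows "F_mat m L n p lm lp C \<rho> \<in> carrier_mat (p * (lm + lp)) (p * (lm + lp) + (n * p + p))"
    and "K_mat m L n p lm lp C \<rho> \<in> carrier_mat (p + (p + (lm * p + (p + (p + lp * p))))) (p * (lm + lp) + (n * p + p))"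
  using assms by (auto intro!: carrier_matI simp: F_mat_def K_mat_def mult.commute)

lemma F_mat_mult:
  fixes m L \<rho> :: real
  assumes "C \<in> carrier_mat p (n * p)" "x \<in> carrier_vec (n * p)" "u \<in> carrier_vec p"
  defines "a \<equiv> (L - m) \<cdot>\<^sub>v ((1 / \<rho>) \<cdot>\<^sub>v (C *\<^sub>v x)) - u"
  shows "F_mat m L n p lm lp C \<rho> *\<^sub>v ((block_vec p lm f @\<^sub>v block_vec p lp g) @\<^sub>v x @\<^sub>v u) =
    block_vec p lm (\<lambda>i e. if Suc i < lm then f (Suc i) e else a $ e) @\<^sub>v
    block_vec p lp (\<lambda>i e. if Suc i < lp then g (Suc i) e else u $ e)"
proof -
  have "F_mat m L n p lm lp C \<rho> *\<^sub>v ((block_vec p lm f @\<^sub>v block_vec p lp g) @\<^sub>v x @\<^sub>v u) =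
    A_Delta p lm lp *\<^sub>v (block_vec p lm f @\<^sub>v block_vec p lp g) +
    B_Delta m L p lm lp *\<^sub>v (((1 / \<rho>) \<cdot>\<^sub>v (C *\<^sub>v x)) @\<^sub>v u)"
    unfolding F_mat_def using assms
    by (subst append_cols_mult_vec) (auto simp: input_split_mult algebra_simps)
  also have "\<dots> = block_vec p lm (\<lambda>i e. (if Suc i < lm then f (Suc i) e else 0) + (if Suc i = lm then a $ e else 0)) @\<^sub>v
    block_vec p lp (\<lambda>i e. (if Suc i < lp then g (Suc i) e else 0) + (if Suc i = lp then u $ e else 0))"
    using assms(1-3) by (simp add: A_Delta_mult_block_vec B_Delta_mult)
      (auto intro!: eq_vecI simp: block_vec_def a_def)
  also have "\<dots> = block_vec p lm (\<lambda>i e. if Suc i < lm then f (Suc i) e else a $ e) @\<^sub>v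
    block_vec p lp (\<lambda>i e. if Suc i < lp then g (Suc i) e else u $ e)"
    by (intro arg_cong2[where f = "(@\<^sub>v)"] block_vec_cong) auto
  finally show ?thesis .
qed

lemma K_mat_mult:
  fixes m L \<rho> :: real
  assumes "C \<in> carrier_mat p (n * p)" "x \<in> carrier_vec (n * p)" "u \<in> carrier_vec p"
  defines "a \<equiv> (L - m) \<cdot>\<^sub>v ((1 / \<rho>) \<cdot>\<^sub>v (C *\<^sub>v x)) - u"
  shows "K_mat m L n p lm lp C \<rho> *\<^sub>v ((block_vec p lm f @\<^sub>v block_vec p lp g) @\<^sub>v x @\<^sub>v u) =
    a @\<^sub>v u @\<^sub>v block_vec p lm f @\<^sub>v u @\<^sub>v a @\<^sub>v block_vec p lp (\<lambda>i. g (lp - Suc i))"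
proof -
  have "K_mat m L n p lm lp C \<rho> *\<^sub>v ((block_vec p lm f @\<^sub>v block_vec p lp g) @\<^sub>v x @\<^sub>v u) =
    C_Delta p lm lp *\<^sub>v (block_vec p lm f @\<^sub>v block_vec p lp g) +
    D_Delta m L p lm lp *\<^sub>v (((1 / \<rho>) \<cdot>\<^sub>v (C *\<^sub>v x)) @\<^sub>v u)"
    unfolding K_mat_def using assms
    by (subst append_cols_mult_vec) (auto simp: input_split_mult algebra_simps)
  also have "\<dots> = a @\<^sub>v u @\<^sub>v block_vec p lm f @\<^sub>v u @\<^sub>v a @\<^sub>v block_vec p lp (\<lambda>i. g (lp - Suc i))"
    using assms(1-3)
    by (simp add: C_Delta_mult D_Delta_mult) (simp add: append_vec_add_dim a_def)
  finally show ?thesis .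
qed

text \<open>Every diagonal block has zero diagonal and transposed off-diagonal parts, so it
  contributes one bilinear term twice. Regrouping \<open>z\<close> into three pairs fits it to these
  blocks.\<close>

lemma M_Delta_quadratic_form:
  assumes M: "Mm \<in> carrier_mat p (lm * p)" "M0 \<in> carrier_mat p p" "Mp \<in> carrier_mat p (lp * p)"
    and v: "a \<in> carrier_vec p" "b \<in> carrier_vec p" "v \<in> carrier_vec (lm * p)" "w \<in> carrier_vec (lp * p)"
  defines "z \<equiv> a @\<^sub>v b @\<^sub>v v @\<^sub>v b @\<^sub>v a @\<^sub>v w"
  shows "scalar_prod z (M_Delta p lm lp Mm M0 Mp *\<^sub>v z) =
    2 * (scalar_prod b (M0 *\<^sub>v a) + scalar_prod b (Mm *\<^sub>v v) + scalar_prod a (Mp *\<^sub>v w))"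
proof -
  have z: "z = (a @\<^sub>v b) @\<^sub>v (v @\<^sub>v b) @\<^sub>v (a @\<^sub>v w)"
    by (simp add: z_def append_vec_assoc)
  have t: "scalar_prod x (X\<^sup>T *\<^sub>v y) = scalar_prod y (X *\<^sub>v x)"
    if "X \<in> carrier_mat r c" "x \<in> carrier_vec c" "y \<in> carrier_vec r" for X :: "real mat" and x y r c
    using that comm_scalar_prod[of x c "X\<^sup>T *\<^sub>v y"] transpose_vec_mult_scalar[of X r c x y] by simp
  have "scalar_prod z (M_Delta p lm lp Mm M0 Mp *\<^sub>v z) =
      (scalar_prod a (M0\<^sup>T *\<^sub>v b) + scalar_prod b (M0 *\<^sub>v a)) +
      ((scalar_prod v (Mm\<^sup>T *\<^sub>v b) + scalar_prod b (Mm *\<^sub>v v)) +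
      (scalar_prod a (Mp *\<^sub>v w) + scalar_prod w (Mp\<^sup>T *\<^sub>v a)))"
    unfolding z M_Delta_def using M v
    by (simp add: block_mult_simps scalar_prod_append_dim del: diag_block_mat.simps)
  then show ?thesis
    using t[OF M(1) v(3) v(2)] t[OF M(2) v(1) v(2)] t[OF M(3) v(4) v(1)] by simp
qed

text \<open>Membership provides some family whose concatenation is the given row; comparing entries
  identifies its blocks with \<open>Mm\<close>, \<open>M0\<close> and \<open>Mp\<close>. The
  weighted sums of blocks are scalar multiples of the identity, so component 0 of each vector
  inequality is the scalar condition.\<close>

lemma multiplier_setE:
  assumes "Mm @\<^sub>c M0 @\<^sub>c Mp \<in> multiplier_set \<rho> lp lm p" and "0 < p" and "0 < \<rho>"
    and M: "Mp \<in> carrier_mat p (lp * p)" "Mm \<in> carrier_mat p (lm * p)" "M0 \<in> carrier_mat p p"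
  obtains c :: "int \<Rightarrow> real" where
    "\<And>i. - int lm \<le> i \<Longrightarrow> i \<le> int lp \<Longrightarrow> i \<noteq> 0 \<Longrightarrow> c i \<le> 0"
    "0 \<le> (\<Sum>i\<in>{- int lm..int lp}. c i * \<rho> powi (- i))"
    "0 \<le> (\<Sum>i\<in>{- int lm..int lp}. c i * \<rho> powi i)"
    "M0 = c 0 \<cdot>\<^sub>m 1\<^sub>m p"
    "Mm = Matrix.mat 1 lm (\<lambda>(_, j). c (int j - int lm)) \<otimes>\<^sub>m 1\<^sub>m p"
    "Mp = Matrix.mat 1 lp (\<lambda>(_, j). c (int j + 1)) \<otimes>\<^sub>m 1\<^sub>m p"
proof -
  obtain Mi c where row: "Mm @\<^sub>c M0 @\<^sub>c Mp = foldr (@\<^sub>c) (map Mi [- int lm..int lp]) (0\<^sub>m p 0)"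
    and Mi: "\<And>i. i \<in> {- int lm..int lp} \<Longrightarrow> Mi i = c i \<cdot>\<^sub>m 1\<^sub>m p"
    and c: "\<And>i. i \<in> {- int lm..int lp} \<Longrightarrow> i \<noteq> 0 \<Longrightarrow> c i \<le> (0 :: real)"
    and s1: "0\<^sub>v p \<le> Matrix.mat p p (\<lambda>ab. \<Sum>i\<in>{- int lm..int lp}. Mi i $$ ab * \<rho> powi (- i))
                  *\<^sub>v Matrix.vec p (\<lambda>_. 1)"
    and s2: "0\<^sub>v p \<le> (Matrix.mat p p (\<lambda>ab. \<Sum>i\<in>{- int lm..int lp}. Mi i $$ ab * \<rho> powi i))\<^sup>T
                  *\<^sub>v Matrix.vec p (\<lambda>_. 1)"
    using assms(1) unfolding multiplier_set_def by blast
  have "0 \<le> (Matrix.mat p p (\<lambda>ab. \<Sum>i\<in>{- int lm..int lp}. Mi i $$ ab * \<rho> powi (- i))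
                  *\<^sub>v Matrix.vec p (\<lambda>_. 1)) $ 0"
    using s1 \<open>0 < p\<close> unfolding less_eq_vec_def by (auto simp del: index_mult_mat_vec)
  also have "\<dots> = (\<Sum>e<p. \<Sum>i\<in>{- int lm..int lp}. Mi i $$ (0, e) * \<rho> powi (- i))"
    using \<open>0 < p\<close> by (simp add: scalar_prod_def atLeast0LessThan)
  also have "\<dots> = (\<Sum>e<p. if e = 0 then \<Sum>i\<in>{- int lm..int lp}. c i * \<rho> powi (- i) else 0)"
    using \<open>0 < p\<close> by (intro sum.cong) (auto simp: Mi intro!: sum.neutral)
  finally have sum1: "0 \<le> (\<Sum>i\<in>{- int lm..int lp}. c i * \<rho> powi (- i))"
    using \<open>0 < p\<close> by (simp add: sum.delta)
  have "0 \<le> ((Matrix.mat p p (\<lambda>ab. \<Sum>i\<in>{- int lm..int lp}. Mi i $$ ab * \<rho> powi i))\<^sup>T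
                  *\<^sub>v Matrix.vec p (\<lambda>_. 1)) $ 0"
    using s2 \<open>0 < p\<close> unfolding less_eq_vec_def by (auto simp del: index_mult_mat_vec)
  also have "\<dots> = (\<Sum>e<p. \<Sum>i\<in>{- int lm..int lp}. Mi i $$ (e, 0) * \<rho> powi i)"
    using \<open>0 < p\<close> by (simp add: scalar_prod_def atLeast0LessThan)
  also have "\<dots> = (\<Sum>e<p. if e = 0 then \<Sum>i\<in>{- int lm..int lp}. c i * \<rho> powi i else 0)"
    using \<open>0 < p\<close> by (intro sum.cong) (auto simp: Mi intro!: sum.neutral)
  finally have sum2: "0 \<le> (\<Sum>i\<in>{- int lm..int lp}. c i * \<rho> powi i)"
    using \<open>0 < p\<close> by (simp add: sum.delta)
  have row': "Mm @\<^sub>c M0 @\<^sub>c Mp =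
      Matrix.mat 1 (lm + 1 + lp) (\<lambda>(_, j). c ([- int lm..int lp] ! j)) \<otimes>\<^sub>m 1\<^sub>m p"
    unfolding row using foldr_append_cols_scalar_blocks[OF \<open>0 < p\<close>, of "[- int lm..int lp]" Mi c] Mi
    by (simp add: nat_add_distrib add.commute)
  \<comment> \<open>Block number \<open>j\<close> carries the coefficient with index
    \<open>j - lm\<close>: number \<open>lm\<close> is \<open>M0\<close>, and number
    \<open>lm + 1 + j\<close> is block \<open>j\<close> of \<open>Mp\<close> with index
    \<open>j + 1\<close>.\<close>
  have entry: "(Mm @\<^sub>c M0 @\<^sub>c Mp) $$ (e, j * p + e') = (if e = e' then c (int j - int lm) else 0)"
    if "j < lm + 1 + lp" "e < p" "e' < p" for j e e'
  proof -
    have "j * p + e' < j * p + p" using that by simp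
    also have "\<dots> \<le> (lm + 1 + lp) * p"
      using that mult_le_mono1[of "Suc j" "lm + 1 + lp" p] by simp
    finally have "j * p + e' < (lm + 1 + lp) * p" .
    with that show ?thesis unfolding row' by (simp add: kron_def nth_upto)
  qed
  show ?thesis
  proof
    show "M0 = c 0 \<cdot>\<^sub>m 1\<^sub>m p"
    proof (rule eq_matI)
      fix e e' assume "e < dim_row (c 0 \<cdot>\<^sub>m 1\<^sub>m p)" "e' < dim_col (c 0 \<cdot>\<^sub>m 1\<^sub>m p)"
      with entry[of lm e e'] M show "M0 $$ (e, e') = (c 0 \<cdot>\<^sub>m 1\<^sub>m p) $$ (e, e')"
        by (simp add: index_append_cols)
    qed (use M in auto)
    show "Mm = Matrix.mat 1 lm (\<lambda>(_, j). c (int j - int lm)) \<otimes>\<^sub>m 1\<^sub>m p"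
    proof (rule eq_matI)
      fix e j assume "e < dim_row (Matrix.mat 1 lm (\<lambda>(_, j). c (int j - int lm)) \<otimes>\<^sub>m 1\<^sub>m p)"
        "j < dim_col (Matrix.mat 1 lm (\<lambda>(_, j). c (int j - int lm)) \<otimes>\<^sub>m 1\<^sub>m p)"
      then have *: "e < p" "j < lm * p" by auto
      from entry[of "j div p" e "j mod p"] * block_index[OF *(2)] M
      show "Mm $$ (e, j) = (Matrix.mat 1 lm (\<lambda>(_, j). c (int j - int lm)) \<otimes>\<^sub>m 1\<^sub>m p) $$ (e, j)"
        by (simp add: index_append_cols kron_def)
    qed (use M in auto)
    show "Mp = Matrix.mat 1 lp (\<lambda>(_, j). c (int j + 1)) \<otimes>\<^sub>m 1\<^sub>m p"
    proof (rule eq_matI)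
      fix e j assume "e < dim_row (Matrix.mat 1 lp (\<lambda>(_, j). c (int j + 1)) \<otimes>\<^sub>m 1\<^sub>m p)"
        "j < dim_col (Matrix.mat 1 lp (\<lambda>(_, j). c (int j + 1)) \<otimes>\<^sub>m 1\<^sub>m p)"
      then have *: "e < p" "j < lp * p" by auto
      have eq: "lm * p + (p + j) = (lm + 1 + j div p) * p + j mod p" by (simp add: algebra_simps)
      have "(Mm @\<^sub>c M0 @\<^sub>c Mp) $$ (e, lm * p + (p + j)) = (if e = j mod p then c (int (j div p) + 1) else 0)"
        unfolding eq using * block_index[OF *(2)] by (subst entry) (auto simp: add.commute)
      with * block_index[OF *(2)] M
      show "Mp $$ (e, j) = (Matrix.mat 1 lp (\<lambda>(_, j). c (int j + 1)) \<otimes>\<^sub>m 1\<^sub>m p) $$ (e, j)"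
        by (simp add: index_append_cols kron_def add.commute)
    qed (use M in auto)
  qed (use c sum1 sum2 in auto)
qed

subsection \<open>The multiplier inequality over a finite horizon\<close>

lemma sum_nonpos_subset_nonneg:
  fixes \<phi> :: "'a \<Rightarrow> real"
  assumes "finite I" "J \<subseteq> I" "\<And>i. i \<in> I - J \<Longrightarrow> \<phi> i \<le> 0" "0 \<le> sum \<phi> I"
  shows "0 \<le> sum \<phi> J"
proof -
  have "sum \<phi> I = sum \<phi> J + sum \<phi> (I - J)" using sum.subset_diff[OF assms(2,1)] by (simp add: add.commute)
  moreover have "sum \<phi> (I - J) \<le> 0" using assms(3) by (rule sum_nonpos)
  ultimately show ?thesis using assms(4) by linarith
qed

lemma sum_lagged:
  fixes F :: "nat \<Rightarrow> nat \<Rightarrow> real"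
  shows "(\<Sum>i=1..l. if i \<le> k then F i (k - i) else 0) = (\<Sum>j<k. if k - j \<le> l then F (k - j) j else 0)"
proof -
  have "(\<Sum>i | i \<in> {1..l} \<and> i \<le> k. F i (k - i)) = (\<Sum>j | j \<in> {..<k} \<and> k - j \<le> l. F (k - j) j)"
    by (rule sum.reindex_bij_witness[where i = "\<lambda>j. k - j" and j = "\<lambda>i. k - i"]) auto
  then show ?thesis by (simp flip: sum.inter_filter)
qed

text \<open>Restricting the two-sided sums to the horizon drops nonpositive terms only, so the two
  conditions on the coefficients survive the truncation.\<close>

lemma multiplier_sum_nonneg:
  fixes c :: "int \<Rightarrow> real" and \<alpha> :: "nat \<Rightarrow> nat \<Rightarrow> real"
  assumes c: "\<And>i. - int lm \<le> i \<Longrightarrow> i \<le> int lp \<Longrightarrow> i \<noteq> 0 \<Longrightarrow> c i \<le> 0"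
    and s1: "0 \<le> (\<Sum>i\<in>{- int lm..int lp}. c i * \<rho> powi (- i))"
    and s2: "0 \<le> (\<Sum>i\<in>{- int lm..int lp}. c i * \<rho> powi i)"
    and \<rho>: "0 < \<rho>"
    and G: "\<And>k. 0 \<le> G k" and h: "\<And>k. 0 \<le> h k"
    and diag: "\<And>k. \<alpha> k k = (G k + h k) / \<rho> ^ (2 * k)"
    and offdiag: "\<And>j k. \<alpha> j k \<le> (G j + h k) / \<rho> ^ (j + k)"
  shows "0 \<le> (\<Sum>k<N. c 0 * \<alpha> k k +
      (\<Sum>i=1..lm. if i \<le> k then c (- int i) * \<alpha> (k - i) k else 0) +
      (\<Sum>i=1..lp. if i \<le> k then c (int i) * \<alpha> k (k - i) else 0))"
proof -
  \<comment> \<open>Extension by zero, because \<open>j - k\<close> will range over all differences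
    within the horizon.\<close>
  define d where "d i = (if - int lm \<le> i \<and> i \<le> int lp then c i else 0)" for i
  have d: "d i \<le> 0" if "i \<noteq> 0" for i using c that by (auto simp: d_def)
  \<comment> \<open>\<open>\<sigma>\<close> handles both conditions at once: the identity uses
    \<open>s1\<close>, negation uses \<open>s2\<close>. Since \<open>j < N\<close>, the window of
    differences contains 0, so the one term that may be positive is never cut off.\<close>
  have nonneg: "0 \<le> (\<Sum>k<N. d (\<sigma> (int k - int j)) * \<rho> powi - (int k - int j))"
    if j: "j < N" and \<sigma>: "\<sigma> = (\<lambda>i. i) \<or> \<sigma> = uminus" for j and \<sigma> :: "int \<Rightarrow> int"
  proof -
    define \<phi> where "\<phi> i = d (\<sigma> i) * \<rho> powi - i" for i
    have "0 \<le> sum \<phi> {- int (lm + lp + N)..int (lm + lp + N)}"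
    proof -
      have neq: "sum \<phi> {- int (lm + lp + N)..int (lm + lp + N)} =
          (\<Sum>i\<in>\<sigma> ` {- int lm..int lp}. \<phi> i)"
      proof (rule sum.mono_neutral_right)
        show "\<forall>i\<in>{- int (lm + lp + N)..int (lm + lp + N)} - \<sigma> ` {- int lm..int lp}. \<phi> i = 0"
        proof
          fix i assume i: "i \<in> {- int (lm + lp + N)..int (lm + lp + N)} - \<sigma> ` {- int lm..int lp}"
          have "\<sigma> (\<sigma> i) = i" using \<sigma> by auto
          with i have "\<sigma> i \<notin> {- int lm..int lp}" by (metis DiffD2 imageI)
          then show "\<phi> i = 0" by (auto simp: \<phi>_def d_def)
        qed
      qed (use \<sigma> in auto)
      also have "\<dots> = (\<Sum>i\<in>{- int lm..int lp}. \<phi> (\<sigma> i))"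
        using \<sigma> by (intro sum.reindex[unfolded comp_def]) (auto simp: inj_on_def)
      also have "\<dots> = (\<Sum>i\<in>{- int lm..int lp}. c i * \<rho> powi - \<sigma> i)"
        using \<sigma> by (intro sum.cong) (auto simp: \<phi>_def d_def)
      finally show ?thesis using s1 s2 \<sigma> by auto
    qed
    then have "0 \<le> sum \<phi> ((\<lambda>k. int k - int j) ` {..<N})"
    proof (rule sum_nonpos_subset_nonneg[rotated 3])
      show "(\<lambda>k. int k - int j) ` {..<N} \<subseteq> {- int (lm + lp + N)..int (lm + lp + N)}"
        using j by auto
      fix i assume i: "i \<in> {- int (lm + lp + N)..int (lm + lp + N)} - (\<lambda>k. int k - int j) ` {..<N}"
      then have "i \<noteq> 0" using j by force
      then have "\<sigma> i \<noteq> 0" using \<sigma> by auto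
      then show "\<phi> i \<le> 0" using d \<rho> by (simp add: \<phi>_def mult_nonpos_nonneg)
    qed simp
    also have "sum \<phi> ((\<lambda>k. int k - int j) ` {..<N}) = (\<Sum>k<N. \<phi> (int k - int j))"
      by (intro sum.reindex[unfolded comp_def]) (auto simp: inj_on_def)
    finally show ?thesis by (simp add: \<phi>_def)
  qed
  \<comment> \<open>For \<open>j = k\<close> the bound is an equality, so the sign of
    \<open>d 0\<close> does not matter; otherwise the nonpositive coefficient reverses it.\<close>
  have lower: "d (int j - int k) * ((G j + h k) / \<rho> ^ (j + k)) \<le> d (int j - int k) * \<alpha> j k" for j k
  proof (cases "j = k")
    case True
    then show ?thesis by (simp add: diag mult_2)
  next
    case False
    then show ?thesis using d offdiag by (intro mult_left_mono_neg) auto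
  qed
  \<comment> \<open>\<open>\<rho> ^ (j + k)\<close> is both \<open>\<rho> ^ (2 * j)\<close> times a
    power with exponent \<open>k - j\<close> and \<open>\<rho> ^ (2 * k)\<close> times one with
    exponent \<open>j - k\<close>, so the remaining weights depend on the difference only.\<close>
  have split: "d (int j - int k) * ((G j + h k) / \<rho> ^ (j + k)) =
      G j / \<rho> ^ (2 * j) * (d (- (int k - int j)) * \<rho> powi - (int k - int j)) +
      h k / \<rho> ^ (2 * k) * (d (int j - int k) * \<rho> powi - (int j - int k))" for j k
    using \<rho> by (simp only: power_even_eq) (simp add: power_int_diff power_add power2_eq_square field_simps)
  have "0 \<le> (\<Sum>j<N. G j / \<rho> ^ (2 * j) * (\<Sum>k<N. d (- (int k - int j)) * \<rho> powi - (int k - int j))) +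
      (\<Sum>k<N. h k / \<rho> ^ (2 * k) * (\<Sum>j<N. d (int j - int k) * \<rho> powi - (int j - int k)))"
    by (rule add_nonneg_nonneg; intro sum_nonneg; rule mult_nonneg_nonneg)
       (use nonneg[where \<sigma> = uminus] nonneg[where \<sigma> = "\<lambda>i. i"] G h \<rho> in auto)
  also have "\<dots> = (\<Sum>j<N. \<Sum>k<N. d (int j - int k) * ((G j + h k) / \<rho> ^ (j + k)))"
    unfolding split sum.distrib sum_distrib_left
    by (subst (2) sum.swap) simp
  also have "\<dots> \<le> (\<Sum>j<N. \<Sum>k<N. d (int j - int k) * \<alpha> j k)"
    by (intro sum_mono lower)
  \<comment> \<open>The square of index pairs is summed by adding its last row and column in turn.
    The result is causal: at time \<open>k\<close> only products with times up to \<open>k\<close>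
    occur, as the filter delivers them.\<close>
  also have "\<dots> = (\<Sum>k<N. d (int k - int k) * \<alpha> k k + (\<Sum>j<k. d (int j - int k) * \<alpha> j k) +
      (\<Sum>j<k. d (int k - int j) * \<alpha> k j))"
    by (induction N) (simp_all add: sum.distrib)
  also have "\<dots> = (\<Sum>k<N. c 0 * \<alpha> k k +
      (\<Sum>i=1..lm. if i \<le> k then c (- int i) * \<alpha> (k - i) k else 0) +
      (\<Sum>i=1..lp. if i \<le> k then c (int i) * \<alpha> k (k - i) else 0))"
  proof (rule sum.cong[OF refl], intro arg_cong2[where f = "(+)"])
    fix k
    show "d (int k - int k) * \<alpha> k k = c 0 * \<alpha> k k" by (simp add: d_def)
    show "(\<Sum>j<k. d (int j - int k) * \<alpha> j k) =
        (\<Sum>i=1..lm. if i \<le> k then c (- int i) * \<alpha> (k - i) k else 0)"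
      unfolding sum_lagged[where F = "\<lambda>i j. c (- int i) * \<alpha> j k"]
      by (intro sum.cong) (auto simp: d_def of_nat_diff)
    show "(\<Sum>j<k. d (int k - int j) * \<alpha> k j) =
        (\<Sum>i=1..lp. if i \<le> k then c (int i) * \<alpha> k (k - i) else 0)"
      unfolding sum_lagged[where F = "\<lambda>i j. c (int i) * \<alpha> k j"]
      by (intro sum.cong) (auto simp: d_def of_nat_diff)
  qed
  finally show ?thesis .
qed

subsection \<open>Bounds on quadratic forms\<close>

text \<open>Each product of two entries is at most \<open>scalar_prod x x\<close> in absolute value.
  A crude entrywise constant is enough, as stability asks only for some finite factor.\<close>

lemma quadratic_form_upper:
  fixes X :: "real mat"
  assumes X: "X \<in> carrier_mat N N" and x: "x \<in> carrier_vec N"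
  shows "scalar_prod x (X *\<^sub>v x) \<le> (\<Sum>i<N. \<Sum>j<N. \<bar>X $$ (i, j)\<bar>) * scalar_prod x x"
proof -
  have sq: "(x $ i)\<^sup>2 \<le> scalar_prod x x" if "i < N" for i
  proof -
    have "(x $ i)\<^sup>2 \<le> (\<Sum>i<N. (x $ i)\<^sup>2)" using that by (intro member_le_sum) auto
    then show ?thesis using x by (simp add: scalar_prod_def atLeast0LessThan power2_eq_square)
  qed
  have "scalar_prod x (X *\<^sub>v x) = (\<Sum>i<N. \<Sum>j<N. X $$ (i, j) * (x $ i * x $ j))"
    using X x by (simp add: scalar_prod_def atLeast0LessThan sum_distrib_left mult_ac)
  also have "\<dots> \<le> (\<Sum>i<N. \<Sum>j<N. \<bar>X $$ (i, j)\<bar> * scalar_prod x x)"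
  proof (intro sum_mono)
    fix i j assume "i \<in> {..<N}" "j \<in> {..<N}"
    then have "2 * \<bar>x $ i * x $ j\<bar> \<le> 2 * scalar_prod x x"
      using sq[of i] sq[of j] sum_squares_bound[of "\<bar>x $ i\<bar>" "\<bar>x $ j\<bar>"] by (simp add: abs_mult)
    then have "\<bar>X $$ (i, j)\<bar> * \<bar>x $ i * x $ j\<bar> \<le> \<bar>X $$ (i, j)\<bar> * scalar_prod x x"
      by (intro mult_left_mono) auto
    then show "X $$ (i, j) * (x $ i * x $ j) \<le> \<bar>X $$ (i, j)\<bar> * scalar_prod x x"
      by (metis abs_le_D1 abs_mult)
  qed
  finally show ?thesis by (simp add: sum_distrib_right)
qed

text \<open>Expand \<open>0 \<le> (x - t Y x)\<^sup>T X (x - t Y x)\<close> with \<open>Y = X\<^sup>-\<^sup>1\<close> and \<open>t\<close> the reciprocal of an upper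
  bound of \<open>Y\<close>.\<close>

lemma quadratic_form_lower:
  fixes X Y :: "real mat"
  assumes X: "X \<in> carrier_mat N N" "X\<^sup>T = X" and psd: "\<And>v. v \<in> carrier_vec N \<Longrightarrow> 0 \<le> scalar_prod v (X *\<^sub>v v)"
    and Y: "Y \<in> carrier_mat N N" "X * Y = 1\<^sub>m N" and x: "x \<in> carrier_vec N"
  shows "scalar_prod x x \<le> (1 + (\<Sum>i<N. \<Sum>j<N. \<bar>Y $$ (i, j)\<bar>)) * scalar_prod x (X *\<^sub>v x)"
proof -
  \<comment> \<open>The summand 1 keeps \<open>c\<close> positive. With \<open>t = 1 / c\<close> the
    expansion closes through \<open>2 * t - t\<^sup>2 * c = 1 / c\<close>.\<close>
  define c where "c = 1 + (\<Sum>i<N. \<Sum>j<N. \<bar>Y $$ (i, j)\<bar>)"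
  have c: "1 \<le> c" by (auto simp: c_def intro!: sum_nonneg)
  define t where "t = 1 / c"
  have xx: "0 \<le> scalar_prod x x" using x by (simp add: scalar_prod_def sum_nonneg)
  define z where "z = Y *\<^sub>v x"
  have z: "z \<in> carrier_vec N" using Y x by (simp add: z_def)
  have Xz: "X *\<^sub>v z = x" using X Y x by (simp add: z_def flip: mult_mat_mult_vec)
  have zX: "scalar_prod z (X *\<^sub>v x) = scalar_prod x x"
    using transpose_vec_mult_scalar[OF X(1) x z] by (simp add: X Xz)
  have zx: "scalar_prod z x \<le> c * scalar_prod x x"
  proof -
    have "scalar_prod z x = scalar_prod x (Y *\<^sub>v x)" using z x by (simp add: z_def comm_scalar_prod[of _ N])
    also have "\<dots> \<le> (c - 1) * scalar_prod x x" using quadratic_form_upper[OF Y(1) x] by (simp add: c_def)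
    also have "\<dots> \<le> c * scalar_prod x x" using xx by (simp add: left_diff_distrib)
    finally show ?thesis .
  qed
  have "0 \<le> scalar_prod (x - t \<cdot>\<^sub>v z) (X *\<^sub>v (x - t \<cdot>\<^sub>v z))"
    using x z by (intro psd) auto
  also have "X *\<^sub>v (x - t \<cdot>\<^sub>v z) = X *\<^sub>v x - t \<cdot>\<^sub>v x"
    using X x z Xz by (simp add: mult_minus_distrib_mat_vec[OF X(1)] mult_mat_vec[OF X(1)])
  also have "scalar_prod (x - t \<cdot>\<^sub>v z) (X *\<^sub>v x - t \<cdot>\<^sub>v x) =
      scalar_prod x (X *\<^sub>v x) - 2 * t * scalar_prod x x + t\<^sup>2 * scalar_prod z x"
    using X x z zX
    by (simp add: minus_scalar_prod_distrib[of _ N] scalar_prod_minus_distrib[of _ N] power2_eq_square algebra_simps)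
  also have "\<dots> \<le> scalar_prod x (X *\<^sub>v x) - 2 * t * scalar_prod x x + t\<^sup>2 * (c * scalar_prod x x)"
    using zx by (intro add_left_mono mult_left_mono) auto
  also have "\<dots> = scalar_prod x (X *\<^sub>v x) - scalar_prod x x / c"
    using c by (simp add: t_def power2_eq_square field_simps)
  finally show ?thesis using c by (simp add: c_def[symmetric] field_simps)
qed

text \<open>A nonzero kernel vector would give the form the value 0. The inverse is obtained as the
  value of \<open>mat_inverse\<close>, because the gains \<open>A\<close> and \<open>B\<close> are
  defined through it.\<close>

lemma pos_def_invertible:
  fixes X :: "real mat"
  assumes X: "X \<in> carrier_mat N N"
    and pd: "\<And>v. v \<in> carrier_vec N \<Longrightarrow> v \<noteq> 0\<^sub>v N \<Longrightarrow> 0 < scalar_prod v (X *\<^sub>v v)"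
  obtains Y where "mat_inverse X = Some Y" "Y \<in> carrier_mat N N" "X * Y = 1\<^sub>m N" "Y * X = 1\<^sub>m N"
    "invertible_mat X"
proof -
  have "Determinant.det X \<noteq> 0"
  proof
    assume "Determinant.det X = 0"
    then obtain v where "v \<in> carrier_vec N" "v \<noteq> 0\<^sub>v N" "X *\<^sub>v v = 0\<^sub>v N"
      using det_0_iff_vec_prod_zero_field[OF X] by blast
    with pd[of v] show False by simp
  qed
  then have "X \<in> Units (ring_mat TYPE(real) N ())" by (rule det_non_zero_imp_unit[OF X])
  then obtain Y where Y: "mat_inverse X = Some Y"
    using mat_inverse(1)[OF X, of "()"] by (cases "mat_inverse X") auto
  from mat_inverse(2)[OF X Y] have *: "X * Y = 1\<^sub>m N" "Y * X = 1\<^sub>m N" "Y \<in> carrier_mat N N" by auto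
  then have "invertible_mat X" using X by (auto simp: invertible_mat_def inverts_mat_def)
  with Y * show ?thesis using that by blast
qed

subsection \<open>Dissipation inequality\<close>

text \<open>The \<open>lm\<close> blocks of \<open>f\<close> are the memory for
  \<open>(L - m) y - w\<close>, the \<open>lp\<close> blocks of \<open>g\<close> the memory for
  \<open>w\<close>, both rescaled and oldest first.\<close>

definition filter_state :: "nat \<Rightarrow> nat \<Rightarrow> nat \<Rightarrow> (nat \<Rightarrow> nat \<Rightarrow> real) \<Rightarrow> (nat \<Rightarrow> nat \<Rightarrow> real) \<Rightarrow> real Matrix.vec" where
  "filter_state p lm lp f g = block_vec p lm f @\<^sub>v block_vec p lp g"

lemma filter_state_carrier: "filter_state p lm lp f g \<in> carrier_vec (p * (lm + lp))"
  by (auto simp: filter_state_def algebra_simps intro!: carrier_vecI)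

lemma filter_state_cong:
  "(\<And>i e. i < lm \<Longrightarrow> e < p \<Longrightarrow> f i e = f' i e) \<Longrightarrow> (\<And>i e. i < lp \<Longrightarrow> e < p \<Longrightarrow> g i e = g' i e) \<Longrightarrow>
    filter_state p lm lp f g = filter_state p lm lp f' g'"
  unfolding filter_state_def by (intro arg_cong2[where f = "(@\<^sub>v)"] block_vec_cong)

lemma filter_state_zero: "filter_state p lm lp (\<lambda>_ _. 0) (\<lambda>_ _. 0) = 0\<^sub>v (p * (lm + lp))"
  by (auto simp: filter_state_def block_vec_def algebra_simps dest: block_index intro!: eq_vecI)

locale lmi =
  fixes m L \<rho> :: real and n p lm lp :: nat and C P11 P22 QA QB Mp Mm M0 :: "real mat"
  assumes C: "C \<in> carrier_mat p (n * p)"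
    and P11: "P11 \<in> carrier_mat (p * (lm + lp)) (p * (lm + lp))"
    and P22: "P22 \<in> carrier_mat (n * p) (n * p)" "P22\<^sup>T = P22"
    and QA: "QA \<in> carrier_mat (n * p) (n * p)" and QB: "QB \<in> carrier_mat (n * p) p"
    and M: "Mm \<in> carrier_mat p (lm * p)" "M0 \<in> carrier_mat p p" "Mp \<in> carrier_mat p (lp * p)"
    and neg: "neg_def (lmi_mat m L n p lm lp C \<rho> P11 P22 QA QB (M_Delta p lm lp Mm M0 Mp))"
begin

abbreviation "R \<equiv> 0\<^sub>m (n * p) (p * (lm + lp)) @\<^sub>c ((1 / \<rho>) \<cdot>\<^sub>m QA + (m / \<rho>) \<cdot>\<^sub>m (QB * C)) @\<^sub>c QB"
abbreviation "U \<equiv> U_mat m L n p lm lp C \<rho> P11 P22 (M_Delta p lm lp Mm M0 Mp)"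

lemma U_carrier: "U \<in> carrier_mat (p * (lm + lp) + (n * p + p)) (p * (lm + lp) + (n * p + p))"
  using dim_F_K(2)[OF C, of m L lm lp \<rho>] by (auto simp: U_mat_def intro!: carrier_matI)

lemma R_carrier: "R \<in> carrier_mat (n * p) (p * (lm + lp) + (n * p + p))"
  using QA QB C by (auto intro!: carrier_matI)

lemma R_mult:
  assumes "v \<in> carrier_vec (p * (lm + lp))" "x \<in> carrier_vec (n * p)" "u \<in> carrier_vec p"
  shows "R *\<^sub>v (v @\<^sub>v x @\<^sub>v u) = (1 / \<rho>) \<cdot>\<^sub>v (QA *\<^sub>v x) + (m / \<rho>) \<cdot>\<^sub>v (QB *\<^sub>v (C *\<^sub>v x)) + QB *\<^sub>v u"
  using assms QA QB C
  by (simp add: block_mult_simps add_mult_distrib_mat_vec[of _ "n * p" "n * p"])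

text \<open>The strict version at \<open>s = 0\<close> yields positivity of \<open>P22\<close>; the
  weak one also admits the zero vector and is applied along trajectories.\<close>

lemma lmi_mat_quadratic_form:
  assumes x': "x' \<in> carrier_vec (n * p)" and s: "s \<in> carrier_vec (p * (lm + lp) + (n * p + p))"
  shows "- scalar_prod x' (P22 *\<^sub>v x') + 2 * scalar_prod x' (R *\<^sub>v s) + scalar_prod s (U *\<^sub>v s) \<le> 0"
    and "x' \<noteq> 0\<^sub>v (n * p) \<Longrightarrow>
      - scalar_prod x' (P22 *\<^sub>v x') + 2 * scalar_prod x' (R *\<^sub>v s) + scalar_prod s (U *\<^sub>v s) < 0"
proof -
  let ?X = "lmi_mat m L n p lm lp C \<rho> P11 P22 QA QB (M_Delta p lm lp Mm M0 Mp)"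
  let ?N = "n * p + (p * (lm + lp) + (n * p + p))"
  have X: "?X = four_block_mat (- P22) R (R\<^sup>T) U" by (simp add: lmi_mat_def Let_def)
  have dX: "dim_row ?X = ?N" using P22 U_carrier unfolding X by auto
  have Rs: "scalar_prod s (R\<^sup>T *\<^sub>v x') = scalar_prod x' (R *\<^sub>v s)"
    using transpose_vec_mult_scalar[OF R_carrier s x'] comm_scalar_prod[OF s, of "R\<^sup>T *\<^sub>v x'"] R_carrier x'
    by simp
  have "?X *\<^sub>v (x' @\<^sub>v s) = (- P22 *\<^sub>v x' + R *\<^sub>v s) @\<^sub>v (R\<^sup>T *\<^sub>v x' + U *\<^sub>v s)"
    unfolding X using U_carrier R_carrier P22 x' s by (intro four_block_mat_mult_vec) auto
  then have "scalar_prod (x' @\<^sub>v s) (?X *\<^sub>v (x' @\<^sub>v s)) =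
      scalar_prod x' (- P22 *\<^sub>v x' + R *\<^sub>v s) + scalar_prod s (R\<^sup>T *\<^sub>v x' + U *\<^sub>v s)"
    using U_carrier R_carrier P22 x' s by (simp add: scalar_prod_append_dim)
  also have "scalar_prod x' (- P22 *\<^sub>v x' + R *\<^sub>v s) = - scalar_prod x' (P22 *\<^sub>v x') + scalar_prod x' (R *\<^sub>v s)"
    using R_carrier P22 x' s
    by (subst scalar_prod_add_distrib[of _ "n * p"]) (auto simp: uminus_mult_mat_vec intro!: mult_mat_vec_carrier)
  also have "scalar_prod s (R\<^sup>T *\<^sub>v x' + U *\<^sub>v s) = scalar_prod x' (R *\<^sub>v s) + scalar_prod s (U *\<^sub>v s)"
    using R_carrier U_carrier x' s
    by (subst scalar_prod_add_distrib[of _ "p * (lm + lp) + (n * p + p)"]) (auto simp: Rs intro!: mult_mat_vec_carrier)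
  finally have eq: "scalar_prod (x' @\<^sub>v s) (?X *\<^sub>v (x' @\<^sub>v s)) =
      - scalar_prod x' (P22 *\<^sub>v x') + 2 * scalar_prod x' (R *\<^sub>v s) + scalar_prod s (U *\<^sub>v s)" by simp
  have car: "x' @\<^sub>v s \<in> carrier_vec ?N" using x' s by simp
  have lt: "scalar_prod (x' @\<^sub>v s) (?X *\<^sub>v (x' @\<^sub>v s)) < 0" if "x' @\<^sub>v s \<noteq> 0\<^sub>v ?N"
    using neg car that unfolding neg_def_def dX by blast
  have dX2: "dim_col ?X = ?N" using neg dX unfolding neg_def_def by auto
  have "scalar_prod (x' @\<^sub>v s) (?X *\<^sub>v (x' @\<^sub>v s)) \<le> 0"
  proof (cases "x' @\<^sub>v s = 0\<^sub>v ?N")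
    case True
    then show ?thesis unfolding True using dX dX2 by (simp add: scalar_prod_left_zero carrier_vecI)
  qed (use lt in simp)
  then show "- scalar_prod x' (P22 *\<^sub>v x') + 2 * scalar_prod x' (R *\<^sub>v s) + scalar_prod s (U *\<^sub>v s) \<le> 0"
    unfolding eq .
  show "- scalar_prod x' (P22 *\<^sub>v x') + 2 * scalar_prod x' (R *\<^sub>v s) + scalar_prod s (U *\<^sub>v s) < 0"
    if ne: "x' \<noteq> 0\<^sub>v (n * p)"
  proof -
    have "x' @\<^sub>v s \<noteq> 0\<^sub>v ?N"
    proof
      assume z: "x' @\<^sub>v s = 0\<^sub>v ?N"
      have "x' = 0\<^sub>v (n * p)"
      proof (rule eq_vecI)
        fix i assume "i < dim_vec (0\<^sub>v (n * p) :: real Matrix.vec)"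
        then show "x' $ i = 0\<^sub>v (n * p) $ i" using arg_cong[OF z, of "\<lambda>v. v $ i"] x' by simp
      qed (use x' in auto)
      with ne show False by simp
    qed
    then show ?thesis using lt unfolding eq by blast
  qed
qed

lemma P22_pos:
  assumes "x \<in> carrier_vec (n * p)" "x \<noteq> 0\<^sub>v (n * p)"
  shows "0 < scalar_prod x (P22 *\<^sub>v x)"
proof -
  have "scalar_prod x (R *\<^sub>v 0\<^sub>v (p * (lm + lp) + (n * p + p))) = 0"
    using mult_mat_zero_vec[OF carrier_matD(2)[OF R_carrier]] carrier_matD(1)[OF R_carrier] assms(1)
    by (metis scalar_prod_right_zero)
  with lmi_mat_quadratic_form(2)[OF assms(1) zero_carrier_vec assms(2)] U_carrier show ?thesis
    by simp
qed

text \<open>With \<open>R s = P22 x'\<close> the first two terms of the test, minus the form of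
  \<open>P22\<close> at \<open>x'\<close> plus twice the cross term, collapse to plus that form: the
  value a Schur complement would produce. The form of \<open>U\<close> supplies the new filter term,
  the old storage with a minus sign, and the multiplier term.\<close>

lemma dissipation:
  assumes x: "x \<in> carrier_vec (n * p)" and x': "x' \<in> carrier_vec (n * p)" and u: "u \<in> carrier_vec p"
    and step: "P22 *\<^sub>v x' = (1 / \<rho>) \<cdot>\<^sub>v (QA *\<^sub>v x) + (m / \<rho>) \<cdot>\<^sub>v (QB *\<^sub>v (C *\<^sub>v x)) + QB *\<^sub>v u"
    and a: "a = (L - m) \<cdot>\<^sub>v ((1 / \<rho>) \<cdot>\<^sub>v (C *\<^sub>v x)) - u"
    and \<psi>: "\<psi> = filter_state p lm lp f g"
    and \<psi>': "\<psi>' = filter_state p lm lp (\<lambda>i e. if Suc i < lm then f (Suc i) e else a $ e)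
                 (\<lambda>i e. if Suc i < lp then g (Suc i) e else u $ e)"
  shows "scalar_prod \<psi>' (P11 *\<^sub>v \<psi>') + scalar_prod x' (P22 *\<^sub>v x') +
      2 * (scalar_prod u (M0 *\<^sub>v a) + scalar_prod u (Mm *\<^sub>v block_vec p lm f) +
        scalar_prod a (Mp *\<^sub>v block_vec p lp (\<lambda>i. g (lp - Suc i)))) \<le>
    scalar_prod \<psi> (P11 *\<^sub>v \<psi>) + scalar_prod x (P22 *\<^sub>v x)"
proof -
  define s where "s = \<psi> @\<^sub>v x @\<^sub>v u"
  let ?F = "F_mat m L n p lm lp C \<rho>" and ?K = "K_mat m L n p lm lp C \<rho>"
  let ?M = "M_Delta p lm lp Mm M0 Mp"
  let ?k = "p + (p + (lm * p + (p + (p + lp * p))))" and ?q = "p * (lm + lp)"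
  let ?c = "?q + (n * p + p)"
  have cw: "a \<in> carrier_vec p" using C u x by (auto simp: a intro!: carrier_vecI)
  have c\<psi>: "\<psi> \<in> carrier_vec ?q" unfolding \<psi> by (rule filter_state_carrier)
  have s: "s \<in> carrier_vec ?c" using c\<psi> x u by (auto simp: s_def)
  have MD: "?M \<in> carrier_mat ?k ?k" using M
    by (auto simp: M_Delta_def dim_diag_block_mat intro!: carrier_matI simp del: diag_block_mat.simps)
  note F = dim_F_K(1)[OF C, of m L lm lp \<rho>] and K = dim_F_K(2)[OF C, of m L lm lp \<rho>]
  have Fs: "?F *\<^sub>v s = \<psi>'"
    unfolding s_def \<psi> \<psi>' a filter_state_def by (rule F_mat_mult[OF C x u])
  have Ks: "?K *\<^sub>v s = a @\<^sub>v u @\<^sub>v block_vec p lm f @\<^sub>v u @\<^sub>v a @\<^sub>v block_vec p lp (\<lambda>i. g (lp - Suc i))"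
    unfolding s_def \<psi> a filter_state_def by (rule K_mat_mult[OF C x u])
  let ?D = "diag_block_mat [P11, P22, 0\<^sub>m p p]"
  have D: "?D \<in> carrier_mat ?c ?c" using P11 P22
    by (auto simp: dim_diag_block_mat intro!: carrier_matI simp del: diag_block_mat.simps)
  have FPF: "?F\<^sup>T * P11 * ?F \<in> carrier_mat ?c ?c" using F P11 by (metis mult_carrier_mat transpose_carrier_mat)
  have KMK: "?K\<^sup>T * ?M * ?K \<in> carrier_mat ?c ?c" using K MD by (metis mult_carrier_mat transpose_carrier_mat)
  have "U *\<^sub>v s = (?F\<^sup>T * P11 * ?F) *\<^sub>v s - ?D *\<^sub>v s + (?K\<^sup>T * ?M * ?K) *\<^sub>v s"
    unfolding U_mat_def add_mult_distrib_mat_vec[OF minus_carrier_mat[OF D] KMK s]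
      minus_mult_distrib_mat_vec[OF FPF D s] ..
  then have "scalar_prod s (U *\<^sub>v s) = scalar_prod s ((?F\<^sup>T * P11 * ?F) *\<^sub>v s) - scalar_prod s (?D *\<^sub>v s)
      + scalar_prod s ((?K\<^sup>T * ?M * ?K) *\<^sub>v s)"
    using mult_mat_vec_carrier[OF FPF s] mult_mat_vec_carrier[OF KMK s] mult_mat_vec_carrier[OF D s] s
    by (simp add: scalar_prod_add_distrib[of _ ?c] scalar_prod_minus_distrib[of _ ?c] del: diag_block_mat.simps)
  also have "scalar_prod s ((?F\<^sup>T * P11 * ?F) *\<^sub>v s) = scalar_prod \<psi>' (P11 *\<^sub>v \<psi>')"
    using quadratic_form_congruence[OF F P11 s] unfolding Fs .
  also have "scalar_prod s ((?K\<^sup>T * ?M * ?K) *\<^sub>v s) = 2 * (scalar_prod u (M0 *\<^sub>v a) +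
      scalar_prod u (Mm *\<^sub>v block_vec p lm f) + scalar_prod a (Mp *\<^sub>v block_vec p lp (\<lambda>i. g (lp - Suc i))))"
    unfolding quadratic_form_congruence[OF K MD s] Ks
    by (rule M_Delta_quadratic_form) (use M cw u in auto)
  also have "scalar_prod s (?D *\<^sub>v s) = scalar_prod \<psi> (P11 *\<^sub>v \<psi>) + scalar_prod x (P22 *\<^sub>v x)"
    using P11 P22 c\<psi> x u unfolding s_def
    by (simp add: block_mult_simps scalar_prod_append_dim del: diag_block_mat.simps)
  finally have U: "scalar_prod s (U *\<^sub>v s) = scalar_prod \<psi>' (P11 *\<^sub>v \<psi>') -
      (scalar_prod \<psi> (P11 *\<^sub>v \<psi>) + scalar_prod x (P22 *\<^sub>v x)) +
      2 * (scalar_prod u (M0 *\<^sub>v a) + scalar_prod u (Mm *\<^sub>v block_vec p lm f) +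
        scalar_prod a (Mp *\<^sub>v block_vec p lp (\<lambda>i. g (lp - Suc i))))" .
  have "R *\<^sub>v s = P22 *\<^sub>v x'" unfolding s_def step by (rule R_mult[OF c\<psi> x u])
  with lmi_mat_quadratic_form(1)[OF x' s] U show ?thesis by simp
qed

text \<open>Without input the multiplier term vanishes and the nilpotent filter empties, so positivity of
  \<open>P\<^sub>1\<^sub>1\<close> is a consequence of the matrix inequality.\<close>

lemma P11_nonneg:
  assumes "v \<in> carrier_vec (p * (lm + lp))"
  shows "0 \<le> scalar_prod v (P11 *\<^sub>v v)"
proof -
  \<comment> \<open>The content of a line of length \<open>l\<close> after \<open>k\<close> shifts
    without input. After \<open>lm + lp\<close> shifts both lines are empty, whatever their
    individual lengths.\<close>
  define sh :: "nat \<Rightarrow> nat \<Rightarrow> (nat \<Rightarrow> nat \<Rightarrow> real) \<Rightarrow> nat \<Rightarrow> nat \<Rightarrow> real" where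
    "sh k l f i e = (if i + k < l then f (i + k) e else 0)" for k l f i e
  obtain h where "v = block_vec p (lm + lp) h"
    using block_vec_of_vec[of v "lm + lp" p] assms by (auto simp: mult.commute)
  also have "\<dots> = filter_state p lm lp h (\<lambda>i. h (i + lm))"
    unfolding filter_state_def block_vec_append by (intro block_vec_cong) auto
  finally obtain f g where v: "v = filter_state p lm lp f g" by blast
  define \<psi> where "\<psi> k = filter_state p lm lp (sh k lm f) (sh k lp g)" for k
  have "scalar_prod (\<psi> (Suc k)) (P11 *\<^sub>v \<psi> (Suc k)) \<le> scalar_prod (\<psi> k) (P11 *\<^sub>v \<psi> k)" for k
  proof -
    have 1: "\<psi> (Suc k) = filter_state p lm lp
        (\<lambda>i e. if Suc i < lm then sh k lm f (Suc i) e else 0\<^sub>v p $ e)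
        (\<lambda>i e. if Suc i < lp then sh k lp g (Suc i) e else 0\<^sub>v p $ e)"
      unfolding \<psi>_def by (intro filter_state_cong) (auto simp: sh_def)
    have "scalar_prod (\<psi> (Suc k)) (P11 *\<^sub>v \<psi> (Suc k)) + scalar_prod (0\<^sub>v (n * p)) (P22 *\<^sub>v 0\<^sub>v (n * p)) +
      2 * (scalar_prod (0\<^sub>v p) (M0 *\<^sub>v 0\<^sub>v p) + scalar_prod (0\<^sub>v p) (Mm *\<^sub>v block_vec p lm (sh k lm f)) +
        scalar_prod (0\<^sub>v p) (Mp *\<^sub>v block_vec p lp (\<lambda>i. sh k lp g (lp - Suc i)))) \<le>
      scalar_prod (\<psi> k) (P11 *\<^sub>v \<psi> k) + scalar_prod (0\<^sub>v (n * p)) (P22 *\<^sub>v 0\<^sub>v (n * p))"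
      by (rule dissipation[where g = "sh k lp g"])
         (use C QA QB P22 1 in \<open>auto simp: \<psi>_def intro!: eq_vecI\<close>)
    then show ?thesis using P22 M by simp
  qed
  then have "scalar_prod (\<psi> (lm + lp)) (P11 *\<^sub>v \<psi> (lm + lp)) \<le> scalar_prod (\<psi> 0) (P11 *\<^sub>v \<psi> 0)"
    by (rule lift_Suc_antimono_le) simp
  moreover have "\<psi> (lm + lp) = 0\<^sub>v (p * (lm + lp))"
    unfolding \<psi>_def filter_state_zero[symmetric] by (intro filter_state_cong) (auto simp: sh_def)
  moreover have "\<psi> 0 = v" unfolding \<psi>_def v by (intro filter_state_cong) (auto simp: sh_def)
  ultimately show ?thesis using P11 by simp
qed

end

subsection \<open>Vectors of both kinds\<close>

lemma to_nat_on_bij: "bij_betw (to_nat_on (UNIV :: 'p::finite set)) UNIV {..<CARD('p)}"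
  by (rule to_nat_on_finite) simp

lemma of_vec_to_vec [simp]: "of_vec (to_vec x) = (x :: real^'p::finite)"
proof -
  have "to_nat_on UNIV j < CARD('p)" for j :: 'p
    using bij_betwE[OF to_nat_on_bij] by auto
  then show ?thesis by (simp add: of_vec_def to_vec_def vec_eq_iff countable_finite)
qed

lemma to_vec_carrier [simp]: "to_vec (x :: real^'p::finite) \<in> carrier_vec CARD('p)"
  by (simp add: to_vec_def)

lemma inner_of_vec:
  assumes "v \<in> carrier_vec CARD('p::finite)" "w \<in> carrier_vec CARD('p)"
  shows "inner (of_vec v :: real^'p) (of_vec w) = scalar_prod v w"
proof -
  have "inner (of_vec v :: real^'p) (of_vec w) = (\<Sum>j\<in>UNIV. v $ to_nat_on UNIV (j::'p) * w $ to_nat_on UNIV j)"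
    by (simp add: inner_vec_def of_vec_def)
  also have "\<dots> = (\<Sum>i<CARD('p). v $ i * w $ i)"
    by (rule sum.reindex_bij_betw[OF to_nat_on_bij])
  finally show ?thesis using assms by (simp add: scalar_prod_def atLeast0LessThan)
qed

lemma of_vec_linear:
  assumes "v \<in> carrier_vec CARD('p::finite)" "w \<in> carrier_vec CARD('p)"
  shows of_vec_minus: "(of_vec (v - w) :: real^'p) = of_vec v - of_vec w"
    and of_vec_add: "(of_vec (v + w) :: real^'p) = of_vec v + of_vec w"
    and of_vec_smult: "(of_vec (c \<cdot>\<^sub>v v) :: real^'p) = c *\<^sub>R of_vec v"
  using bij_betwE[OF to_nat_on_bij[where 'p = 'p]] assms
  by (auto simp: of_vec_def Finite_Cartesian_Product.vec_eq_iff)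

lemma S_class_zames_falb_vec:
  fixes H :: "real^'p::finite \<Rightarrow> real"
  assumes "0 < m" "m \<le> L" "H \<in> S_class m L"
    and y: "\<And>k. y k \<in> carrier_vec CARD('p)" and w: "\<And>k. w k = Delta m H y k"
  obtains G h :: "nat \<Rightarrow> real" where
    "\<And>k. 0 \<le> G k" "\<And>k. 0 \<le> h k"
    "\<And>k. scalar_prod ((L - m) \<cdot>\<^sub>v y k - w k) (w k) = G k + h k"
    "\<And>j k. scalar_prod ((L - m) \<cdot>\<^sub>v y j - w j) (w k) \<le> G j + h k"
proof -
  let ?g = "\<lambda>x. gradient H (x + minimizer H) - m *\<^sub>R x"
  obtain G h :: "real^'p \<Rightarrow> real" where
    *: "\<And>x. 0 \<le> G x" "\<And>x. 0 \<le> h x"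
    "\<And>x. inner ((L - m) *\<^sub>R x - ?g x) (?g x) = G x + h x"
    "\<And>x y. inner ((L - m) *\<^sub>R x - ?g x) (?g y) \<le> G x + h y"
    using S_class_zames_falb[OF assms(1,3,2)] by blast
  have wc: "w k \<in> carrier_vec CARD('p)" for k using y[of k] by (auto simp: w Delta_def)
  have wo: "of_vec (w k) = ?g (of_vec (y k))" for k
    using y[of k] by (simp add: w Delta_def of_vec_minus of_vec_smult[where w = "y k"])
  have "scalar_prod ((L - m) \<cdot>\<^sub>v y j - w j) (w k) =
      inner ((L - m) *\<^sub>R of_vec (y j) - ?g (of_vec (y j))) (?g (of_vec (y k)))" for j k
  proof -
    have "scalar_prod ((L - m) \<cdot>\<^sub>v y j - w j) (w k) =
        inner (of_vec ((L - m) \<cdot>\<^sub>v y j - w j) :: real^'p) (of_vec (w k))"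
      using y[of j] wc[of k] wc[of j] by (subst inner_of_vec) auto
    also have "of_vec ((L - m) \<cdot>\<^sub>v y j - w j) = (L - m) *\<^sub>R of_vec (y j) - (of_vec (w j) :: real^'p)"
      using y[of j] wc[of j] by (simp add: of_vec_minus of_vec_smult[where w = "y j"])
    finally show ?thesis by (simp add: wo)
  qed
  with * show ?thesis using that[of "\<lambda>k. G (of_vec (y k))" "\<lambda>k. h (of_vec (y k))"] by simp
qed

subsection \<open>Stability\<close>

lemma scalar_prod_scaled_block_row:
  assumes "w \<in> carrier_vec p"
  shows "scalar_prod w ((Matrix.mat 1 l (\<lambda>(_, j). c j) \<otimes>\<^sub>m 1\<^sub>m p) *\<^sub>v block_vec p l f) =
    (\<Sum>j<l. c j * (\<Sum>e<p. w $ e * f j e))"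
proof -
  have "scalar_prod w ((Matrix.mat 1 l (\<lambda>(_, j). c j) \<otimes>\<^sub>m 1\<^sub>m p) *\<^sub>v block_vec p l f) =
      scalar_prod (block_vec p 1 (\<lambda>_ e. w $ e)) (block_vec p 1 (\<lambda>_ e. \<Sum>j<l. c j * f j e))"
    using block_vec_of_single[OF assms]
    by (auto simp: kron_one_mult_block_vec simp del: One_nat_def intro!: arg_cong2[where f = scalar_prod] block_vec_cong)
  also have "\<dots> = (\<Sum>e<p. \<Sum>j<l. c j * (w $ e * f j e))"
    unfolding scalar_prod_block_vec by (simp add: sum_distrib_left mult_ac)
  also have "\<dots> = (\<Sum>j<l. c j * (\<Sum>e<p. w $ e * f j e))"
    by (subst sum.swap) (simp add: sum_distrib_left)
  finally show ?thesis .
qed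

lemma scalar_prod_sum: "v \<in> carrier_vec p \<Longrightarrow> w \<in> carrier_vec p \<Longrightarrow> scalar_prod v w = (\<Sum>e<p. v $ e * w $ e)"
  by (simp add: scalar_prod_def atLeast0LessThan)

text \<open>Block \<open>i\<close> at time \<open>k\<close> is the input from time
  \<open>k + i - l\<close>, so \<open>i = 0\<close> is the oldest. The guard encodes the start at
  rest; without it truncated subtraction would read \<open>v 0\<close> for all earlier
  times.\<close>

definition delay_line :: "nat \<Rightarrow> (nat \<Rightarrow> real Matrix.vec) \<Rightarrow> nat \<Rightarrow> nat \<Rightarrow> nat \<Rightarrow> real" where
  "delay_line l v k i e = (if l \<le> k + i then v (k + i - l) $ e else 0)"

lemma delay_line_Suc:
  "i < l \<Longrightarrow> delay_line l v (Suc k) i e = (if Suc i < l then delay_line l v k (Suc i) e else v k $ e)"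
  by (auto simp: delay_line_def not_less less_Suc_eq_le le_Suc_eq dest: le_antisym)

context lmi
begin

lemma lyapunov_decay:
  assumes p: "0 < p" and \<rho>: "0 < \<rho>" and mult: "Mm @\<^sub>c M0 @\<^sub>c Mp \<in> multiplier_set \<rho> lp lm p"
    and A: "Ac \<in> carrier_mat (n * p) (n * p)" "P22 * Ac = QA + m \<cdot>\<^sub>m (QB * C)"
    and B: "B \<in> carrier_mat (n * p) p" "P22 * B = QB"
    and \<xi>: "\<And>k. \<xi> k \<in> carrier_vec (n * p)" and w: "\<And>k. w k \<in> carrier_vec p"
    and step: "\<And>k. \<xi> (Suc k) = Ac *\<^sub>v \<xi> k + B *\<^sub>v w k"
    and G: "\<And>k. 0 \<le> G k" and h: "\<And>k. 0 \<le> h k"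
    and diag: "\<And>k. scalar_prod ((L - m) \<cdot>\<^sub>v (C *\<^sub>v \<xi> k) - w k) (w k) = G k + h k"
    and offdiag: "\<And>j k. scalar_prod ((L - m) \<cdot>\<^sub>v (C *\<^sub>v \<xi> j) - w j) (w k) \<le> G j + h k"
  shows "scalar_prod (\<xi> N) (P22 *\<^sub>v \<xi> N) \<le> \<rho> ^ (2 * N) * scalar_prod (\<xi> 0) (P22 *\<^sub>v \<xi> 0)"
proof -
  obtain c where c: "\<And>i. - int lm \<le> i \<Longrightarrow> i \<le> int lp \<Longrightarrow> i \<noteq> 0 \<Longrightarrow> c i \<le> 0"
    "0 \<le> (\<Sum>i\<in>{- int lm..int lp}. c i * \<rho> powi (- i))"
    "0 \<le> (\<Sum>i\<in>{- int lm..int lp}. c i * \<rho> powi i)"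
    and Mc: "M0 = c 0 \<cdot>\<^sub>m 1\<^sub>m p"
    "Mm = Matrix.mat 1 lm (\<lambda>(_, j). c (int j - int lm)) \<otimes>\<^sub>m 1\<^sub>m p"
    "Mp = Matrix.mat 1 lp (\<lambda>(_, j). c (int j + 1)) \<otimes>\<^sub>m 1\<^sub>m p"
    using multiplier_setE[OF mult p \<rho> M(3,1,2)] by blast
  define x where "x k = (1 / \<rho> ^ k) \<cdot>\<^sub>v \<xi> k" for k
  \<comment> \<open>The exponent is \<open>Suc k\<close> because \<open>w k\<close> drives
    \<open>\<xi> (Suc k)\<close>. The factor \<open>1 / \<rho>\<close> in \<open>a\<close> brings
    \<open>y\<close> to the same scale, so every product in \<open>\<alpha>\<close> carries an extra
    \<open>1 / \<rho>\<^sup>2\<close>.\<close>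
  define u where "u k = (1 / \<rho> ^ Suc k) \<cdot>\<^sub>v w k" for k
  define a where "a k = (L - m) \<cdot>\<^sub>v ((1 / \<rho>) \<cdot>\<^sub>v (C *\<^sub>v x k)) - u k" for k
  define \<psi> where "\<psi> k = filter_state p lm lp (delay_line lm a k) (delay_line lp u k)" for k
  define V where "V k = scalar_prod (\<psi> k) (P11 *\<^sub>v \<psi> k) + scalar_prod (x k) (P22 *\<^sub>v x k)" for k
  define \<alpha> where "\<alpha> j k = scalar_prod (a j) (u k)" for j k
  have xc: "x k \<in> carrier_vec (n * p)" for k using \<xi>[of k] by (simp add: x_def)
  have uc: "u k \<in> carrier_vec p" for k using w[of k] by (simp add: u_def)
  have ac: "a k \<in> carrier_vec p" for k using C uc[of k] by (auto simp: a_def intro!: carrier_vecI)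
  have a: "a k = (1 / \<rho> ^ Suc k) \<cdot>\<^sub>v ((L - m) \<cdot>\<^sub>v (C *\<^sub>v \<xi> k) - w k)" for k
    using C \<xi>[of k] w[of k] \<rho> unfolding a_def x_def u_def
    by (intro eq_vecI) (auto simp: field_simps)
  have \<alpha>: "\<alpha> j k = scalar_prod ((L - m) \<cdot>\<^sub>v (C *\<^sub>v \<xi> j) - w j) (w k) / \<rho> ^ 2 / \<rho> ^ (j + k)" for j k
  proof -
    have "(L - m) \<cdot>\<^sub>v (C *\<^sub>v \<xi> j) - w j \<in> carrier_vec p" using C w[of j] by (auto intro!: carrier_vecI)
    then show ?thesis using w[of k] unfolding \<alpha>_def a u_def by (simp add: power_add power2_eq_square)
  qed
  have T: "scalar_prod (u k) (M0 *\<^sub>v a k) + scalar_prod (u k) (Mm *\<^sub>v block_vec p lm (delay_line lm a k)) +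
      scalar_prod (a k) (Mp *\<^sub>v block_vec p lp (\<lambda>i. delay_line lp u k (lp - Suc i))) =
    c 0 * \<alpha> k k +
      (\<Sum>i=1..lm. if i \<le> k then c (- int i) * \<alpha> (k - i) k else 0) +
      (\<Sum>i=1..lp. if i \<le> k then c (int i) * \<alpha> k (k - i) else 0)" for k
  proof (intro arg_cong2[where f = "(+)"])
    show "scalar_prod (u k) (M0 *\<^sub>v a k) = c 0 * \<alpha> k k"
      using ac[of k] uc[of k] comm_scalar_prod[OF ac[of k] uc[of k]]
      by (simp add: Mc \<alpha>_def smult_mat_mult_vec one_mat_mult_vec)
    have "scalar_prod (u k) (Mm *\<^sub>v block_vec p lm (delay_line lm a k)) =
        (\<Sum>j<lm. c (int j - int lm) * (\<Sum>e<p. u k $ e * delay_line lm a k j e))"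
      unfolding Mc by (rule scalar_prod_scaled_block_row[OF uc])
    also have "\<dots> = (\<Sum>j<lm. if lm \<le> k + j then c (int j - int lm) * \<alpha> (k + j - lm) k else 0)"
      using ac uc by (intro sum.cong refl)
        (simp add: delay_line_def \<alpha>_def scalar_prod_sum[of _ p] mult.commute)
    also have "\<dots> = (\<Sum>i=1..lm. if i \<le> k then c (- int i) * \<alpha> (k - i) k else 0)"
      by (rule sum.reindex_bij_witness[where i = "\<lambda>i. lm - i" and j = "\<lambda>j. lm - j"])
         (auto simp: of_nat_diff)
    finally show "scalar_prod (u k) (Mm *\<^sub>v block_vec p lm (delay_line lm a k)) =
      (\<Sum>i=1..lm. if i \<le> k then c (- int i) * \<alpha> (k - i) k else 0)" .
    have "scalar_prod (a k) (Mp *\<^sub>v block_vec p lp (\<lambda>i. delay_line lp u k (lp - Suc i))) =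
        (\<Sum>j<lp. c (int j + 1) * (\<Sum>e<p. a k $ e * delay_line lp u k (lp - Suc j) e))"
      unfolding Mc by (rule scalar_prod_scaled_block_row[OF ac])
    also have "\<dots> = (\<Sum>j<lp. if Suc j \<le> k then c (int (Suc j)) * \<alpha> k (k - Suc j) else 0)"
    proof (intro sum.cong refl)
      \<comment> \<open>Block \<open>lp - Suc j\<close> holds the input of lag \<open>Suc j\<close>,
        which exists only from time \<open>Suc j\<close> on.\<close>
      fix j assume "j \<in> {..<lp}"
      then have "lp \<le> k + (lp - Suc j) \<longleftrightarrow> Suc j \<le> k" "Suc j \<le> k \<Longrightarrow> k + (lp - Suc j) - lp = k - Suc j"
        by auto
      then show "c (int j + 1) * (\<Sum>e<p. a k $ e * delay_line lp u k (lp - Suc j) e) =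
          (if Suc j \<le> k then c (int (Suc j)) * \<alpha> k (k - Suc j) else 0)"
        using ac uc by (simp add: delay_line_def \<alpha>_def scalar_prod_sum[of _ p] add.commute)
    qed
    also have "\<dots> = (\<Sum>i=1..lp. if i \<le> k then c (int i) * \<alpha> k (k - i) else 0)"
      by (rule sum.reindex_bij_witness[where i = "\<lambda>i. i - 1" and j = Suc]) auto
    finally show "scalar_prod (a k) (Mp *\<^sub>v block_vec p lp (\<lambda>i. delay_line lp u k (lp - Suc i))) =
      (\<Sum>i=1..lp. if i \<le> k then c (int i) * \<alpha> k (k - i) else 0)" .
  qed
  have dec: "V (Suc k) + 2 * (c 0 * \<alpha> k k +
      (\<Sum>i=1..lm. if i \<le> k then c (- int i) * \<alpha> (k - i) k else 0) +
      (\<Sum>i=1..lp. if i \<le> k then c (int i) * \<alpha> k (k - i) else 0)) \<le> V k" for k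
    unfolding V_def T[symmetric]
  proof (rule dissipation[OF xc xc uc _ a_def \<psi>_def])
    have "P22 *\<^sub>v \<xi> (Suc k) = QA *\<^sub>v \<xi> k + m \<cdot>\<^sub>v (QB *\<^sub>v (C *\<^sub>v \<xi> k)) + QB *\<^sub>v w k"
    proof -
      have "P22 *\<^sub>v \<xi> (Suc k) = P22 *\<^sub>v (Ac *\<^sub>v \<xi> k) + P22 *\<^sub>v (B *\<^sub>v w k)"
        unfolding step using P22 A B \<xi>[of k] w[of k]
        by (subst mult_add_distrib_mat_vec[of _ "n * p" "n * p"]) auto
      also have "P22 *\<^sub>v (Ac *\<^sub>v \<xi> k) = (QA + m \<cdot>\<^sub>m (QB * C)) *\<^sub>v \<xi> k"
        unfolding A(2)[symmetric] using P22 A(1) \<xi>[of k] by (simp add: mult_mat_mult_vec)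
      also have "\<dots> = QA *\<^sub>v \<xi> k + m \<cdot>\<^sub>v (QB *\<^sub>v (C *\<^sub>v \<xi> k))"
        using QA QB C \<xi>[of k]
        by (simp add: add_mult_distrib_mat_vec[of _ "n * p" "n * p"] smult_mat_mult_vec mult_mat_mult_vec)
      also have "P22 *\<^sub>v (B *\<^sub>v w k) = QB *\<^sub>v w k"
        unfolding B(2)[symmetric] using P22 B(1) w[of k] by (simp add: mult_mat_mult_vec)
      finally show ?thesis .
    qed
    then have "P22 *\<^sub>v x (Suc k) = (1 / \<rho> ^ Suc k) \<cdot>\<^sub>v (QA *\<^sub>v \<xi> k + m \<cdot>\<^sub>v (QB *\<^sub>v (C *\<^sub>v \<xi> k)) + QB *\<^sub>v w k)"
      unfolding x_def using mult_mat_vec[OF P22(1) \<xi>] by simp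
    also have "\<dots> = (1 / \<rho>) \<cdot>\<^sub>v (QA *\<^sub>v x k) + (m / \<rho>) \<cdot>\<^sub>v (QB *\<^sub>v (C *\<^sub>v x k)) + QB *\<^sub>v u k"
    proof -
      have "QA *\<^sub>v x k = (1 / \<rho> ^ k) \<cdot>\<^sub>v (QA *\<^sub>v \<xi> k)" "C *\<^sub>v x k = (1 / \<rho> ^ k) \<cdot>\<^sub>v (C *\<^sub>v \<xi> k)"
        unfolding x_def using mult_mat_vec[OF QA \<xi>] mult_mat_vec[OF C \<xi>] by auto
      moreover have "QB *\<^sub>v ((1 / \<rho> ^ k) \<cdot>\<^sub>v (C *\<^sub>v \<xi> k)) = (1 / \<rho> ^ k) \<cdot>\<^sub>v (QB *\<^sub>v (C *\<^sub>v \<xi> k))"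
        using C \<xi>[of k] by (intro mult_mat_vec[OF QB]) auto
      moreover have "QB *\<^sub>v u k = (1 / \<rho> ^ Suc k) \<cdot>\<^sub>v (QB *\<^sub>v w k)"
        unfolding u_def by (rule mult_mat_vec[OF QB w])
      ultimately show ?thesis using QA QB \<rho> by (intro eq_vecI) (auto simp: field_simps simp del: index_mult_mat_vec)
    qed
    finally show "P22 *\<^sub>v x (Suc k) = (1 / \<rho>) \<cdot>\<^sub>v (QA *\<^sub>v x k) + (m / \<rho>) \<cdot>\<^sub>v (QB *\<^sub>v (C *\<^sub>v x k)) + QB *\<^sub>v u k" .
    show "\<psi> (Suc k) = filter_state p lm lp
        (\<lambda>i e. if Suc i < lm then delay_line lm a k (Suc i) e else a k $ e)
        (\<lambda>i e. if Suc i < lp then delay_line lp u k (Suc i) e else u k $ e)"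
      unfolding \<psi>_def by (intro filter_state_cong) (simp_all add: delay_line_Suc)
  qed
  have sumV: "V N + 2 * (\<Sum>k<N. c 0 * \<alpha> k k +
      (\<Sum>i=1..lm. if i \<le> k then c (- int i) * \<alpha> (k - i) k else 0) +
      (\<Sum>i=1..lp. if i \<le> k then c (int i) * \<alpha> k (k - i) else 0)) \<le> V 0"
  proof (induction N)
    case (Suc N)
    with dec[of N] show ?case by (simp only: sum.lessThan_Suc distrib_left)
  qed simp
  have "0 \<le> (\<Sum>k<N. c 0 * \<alpha> k k +
      (\<Sum>i=1..lm. if i \<le> k then c (- int i) * \<alpha> (k - i) k else 0) +
      (\<Sum>i=1..lp. if i \<le> k then c (int i) * \<alpha> k (k - i) else 0))"
  \<comment> \<open>The extra factor \<open>1 / \<rho>\<^sup>2\<close> of the products is absorbed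
    into \<open>G\<close> and \<open>h\<close>.\<close>
  proof (rule multiplier_sum_nonneg[OF c \<rho>, where G = "\<lambda>k. G k / \<rho>\<^sup>2" and h = "\<lambda>k. h k / \<rho>\<^sup>2"])
    show "\<alpha> k k = (G k / \<rho>\<^sup>2 + h k / \<rho>\<^sup>2) / \<rho> ^ (2 * k)" for k
      unfolding \<alpha> diag by (simp add: add_divide_distrib mult_2)
    show "\<alpha> j k \<le> (G j / \<rho>\<^sup>2 + h k / \<rho>\<^sup>2) / \<rho> ^ (j + k)" for j k
      unfolding \<alpha> add_divide_distrib[symmetric] using offdiag \<rho> by (intro divide_right_mono) auto
  qed (use G h in auto)
  with sumV have "V N \<le> V 0" by linarith
  moreover have "\<psi> 0 = 0\<^sub>v (p * (lm + lp))"
    unfolding \<psi>_def filter_state_zero[symmetric] by (intro filter_state_cong) (auto simp: delay_line_def)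
  moreover have "0 \<le> scalar_prod (\<psi> N) (P11 *\<^sub>v \<psi> N)"
    unfolding \<psi>_def by (intro P11_nonneg filter_state_carrier)
  ultimately have "scalar_prod (x N) (P22 *\<^sub>v x N) \<le> scalar_prod (\<xi> 0) (P22 *\<^sub>v \<xi> 0)"
    using P11 by (simp add: V_def x_def)
  also have "scalar_prod (x N) (P22 *\<^sub>v x N) = scalar_prod (\<xi> N) (P22 *\<^sub>v \<xi> N) / \<rho> ^ (2 * N)"
  proof -
    have "P22 *\<^sub>v x N = (1 / \<rho> ^ N) \<cdot>\<^sub>v (P22 *\<^sub>v \<xi> N)"
      unfolding x_def by (rule mult_mat_vec[OF P22(1) \<xi>])
    then show ?thesis using P22 \<xi>[of N] by (simp add: x_def power_even_eq power2_eq_square)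
  qed
  finally show ?thesis using \<rho> by (simp add: field_simps)
qed

text \<open>Passing from the form of \<open>P22\<close> to the Euclidean norm costs
  \<open>c1\<close> (from the inverse of \<open>P22\<close>) at time \<open>N\<close> and
  \<open>c2\<close> (from \<open>P22\<close> itself) at time 0. Their product acts as a condition
  number of \<open>P22\<close> and serves as \<open>\<eta>\<close> for every
  \<open>H\<close>.\<close>

lemma closed_loop_stable:
  fixes Ac B :: "real mat"
  assumes p: "p = CARD('p::finite)" and "0 < m" "m \<le> L" and \<rho>: "0 < \<rho>"
    and mult: "Mm @\<^sub>c M0 @\<^sub>c Mp \<in> multiplier_set \<rho> lp lm p"
    and A: "Ac \<in> carrier_mat (n * p) (n * p)" "P22 * Ac = QA + m \<cdot>\<^sub>m (QB * C)"
    and B: "B \<in> carrier_mat (n * p) p" "P22 * B = QB"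
  shows "robustly_exp_stable Ac B C (Delta m ` (S_class m L :: (real^'p \<Rightarrow> real) set)) \<rho>"
proof -
  obtain Y where Y: "Y \<in> carrier_mat (n * p) (n * p)" "P22 * Y = 1\<^sub>m (n * p)"
    using pos_def_invertible[OF P22(1) P22_pos] by blast
  define c1 where "c1 = 1 + (\<Sum>i<n * p. \<Sum>j<n * p. \<bar>Y $$ (i, j)\<bar>)"
  define c2 where "c2 = 1 + (\<Sum>i<n * p. \<Sum>j<n * p. \<bar>P22 $$ (i, j)\<bar>)"
  have c1: "1 \<le> c1" and c2: "1 \<le> c2" by (auto simp: c1_def c2_def intro!: sum_nonneg)
  have psd: "0 \<le> scalar_prod v (P22 *\<^sub>v v)" if "v \<in> carrier_vec (n * p)" for v
  proof (cases "v = 0\<^sub>v (n * p)")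
    case True
    then show ?thesis using P22(1) by simp
  qed (use P22_pos[OF that] in simp)
  have decay: "scalar_prod (\<xi> N) (\<xi> N) \<le> (c1 * c2) * \<rho> ^ (2 * N) * scalar_prod (\<xi> 0) (\<xi> 0)"
    if H: "H \<in> (S_class m L :: (real^'p \<Rightarrow> real) set)" and \<xi>0: "\<xi> 0 \<in> carrier_vec (n * p)"
      and dyn: "\<And>k. \<xi> (Suc k) = Ac *\<^sub>v \<xi> k + B *\<^sub>v w k" "\<And>k. y k = C *\<^sub>v \<xi> k" "\<And>k. w k = Delta m H y k"
    for H \<xi> y w N
  proof -
    have yc: "y k \<in> carrier_vec p" for k using C by (auto simp: dyn(2) intro!: carrier_vecI)
    have wc: "w k \<in> carrier_vec p" for k using yc[of k] by (auto simp: dyn(3) Delta_def p)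
    have \<xi>c: "\<xi> k \<in> carrier_vec (n * p)" for k
      by (cases k) (use \<xi>0 A B in \<open>auto simp: dyn(1) intro!: carrier_vecI\<close>)
    obtain G h :: "nat \<Rightarrow> real" where Gh: "\<And>k. 0 \<le> G k" "\<And>k. 0 \<le> h k"
      "\<And>k. scalar_prod ((L - m) \<cdot>\<^sub>v y k - w k) (w k) = G k + h k"
      "\<And>j k. scalar_prod ((L - m) \<cdot>\<^sub>v y j - w j) (w k) \<le> G j + h k"
      using S_class_zames_falb_vec[OF assms(2,3) H yc[unfolded p] dyn(3)] by blast
    have "0 < p" by (simp add: p)
    have "scalar_prod (\<xi> N) (\<xi> N) \<le> c1 * scalar_prod (\<xi> N) (P22 *\<^sub>v \<xi> N)"
      unfolding c1_def by (rule quadratic_form_lower[OF P22 psd Y \<xi>c])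
    also have "\<dots> \<le> c1 * (\<rho> ^ (2 * N) * scalar_prod (\<xi> 0) (P22 *\<^sub>v \<xi> 0))"
      using c1 lyapunov_decay[where \<xi> = \<xi> and w = w and G = G and h = h, OF \<open>0 < p\<close> \<rho> mult A B \<xi>c wc dyn(1) Gh(1,2) Gh(3,4)[unfolded dyn(2)]]
      by (intro mult_left_mono) auto
    also have "\<dots> \<le> c1 * (\<rho> ^ (2 * N) * (c2 * scalar_prod (\<xi> 0) (\<xi> 0)))"
    proof -
      have "0 \<le> scalar_prod (\<xi> 0) (\<xi> 0)" using \<xi>0 by (simp add: scalar_prod_def sum_nonneg)
      then have "scalar_prod (\<xi> 0) (P22 *\<^sub>v \<xi> 0) \<le> c2 * scalar_prod (\<xi> 0) (\<xi> 0)"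
        using quadratic_form_upper[OF P22(1) \<xi>0] by (simp add: c2_def distrib_right)
      then show ?thesis using c1 \<rho> by (intro mult_left_mono) auto
    qed
    finally show ?thesis by (simp add: mult_ac)
  qed
  show ?thesis
    unfolding robustly_exp_stable_def
  proof (intro exI[of _ "c1 * c2"] conjI ballI allI impI)
    show "0 < c1 * c2" using c1 c2 by simp
    fix \<Delta> \<xi> y w k
    assume "\<Delta> \<in> Delta m ` (S_class m L :: (real^'p \<Rightarrow> real) set)"
      and dyn: "\<xi> 0 \<in> carrier_vec (dim_col Ac) \<and>
        (\<forall>k. \<xi> (Suc k) = Ac *\<^sub>v \<xi> k + B *\<^sub>v w k \<and> y k = C *\<^sub>v \<xi> k \<and> w k = \<Delta> y k)"
    then obtain H where "H \<in> (S_class m L :: (real^'p \<Rightarrow> real) set)" "\<Delta> = Delta m H" by blast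
    with dyn A(1) show "scalar_prod (\<xi> k) (\<xi> k) \<le> c1 * c2 * \<rho> ^ (2 * k) * scalar_prod (\<xi> 0) (\<xi> 0)"
      by (intro decay[where H = H and w = w and y = y]) auto
  qed
qed

end

section \<open>From the deviation system back to the algorithm\<close>

lemma first_block_carrier: "first_block n p \<in> carrier_mat p (n * p)"
  by (auto simp: first_block_def intro!: carrier_matI)

lemma first_block_mult_transpose:
  assumes "1 \<le> n"
  shows "first_block n p * (first_block n p)\<^sup>T = 1\<^sub>m p"
proof (rule eq_matI)
  fix i j assume "i < dim_row (1\<^sub>m p :: real mat)" "j < dim_col (1\<^sub>m p :: real mat)"
  then have ij: "i < p" "j < p" by auto
  moreover have "p \<le> n * p" using assms by simp
  ultimately have le: "i < n * p" "j < n * p" by linarith+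
  have entry: "first_block n p $$ (i, k) = (if k = i then 1 else 0)" if "i < p" "k < n * p" for i k
  proof (cases "k < p")
    case True
    then show ?thesis using that assms by (auto simp: first_block_def kron_def)
  next
    case False
    then have "k div p \<noteq> 0" using that by (simp add: div_eq_0_iff)
    then show ?thesis using that False block_index[OF that(2)] by (auto simp: first_block_def kron_def)
  qed
  have "(first_block n p * (first_block n p)\<^sup>T) $$ (i, j) =
      (\<Sum>k<n * p. first_block n p $$ (i, k) * first_block n p $$ (j, k))"
    using ij first_block_carrier[of n p] by (simp add: scalar_prod_def atLeast0LessThan)
  also have "\<dots> = (\<Sum>k<n * p. if k = i then (if i = j then 1 else 0) else 0)"
    using ij by (intro sum.cong) (auto simp: entry)
  also have "\<dots> = 1\<^sub>m p $$ (i, j)" using ij le by (simp add: sum.delta)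
  finally show "(first_block n p * (first_block n p)\<^sup>T) $$ (i, j) = 1\<^sub>m p $$ (i, j)" .
qed (use first_block_carrier[of n p] in auto)

text \<open>\<open>A * C\<^sup>T = C\<^sup>T\<close> lets \<open>A\<close> fix the point
  \<open>C\<^sup>T z\<close>, and \<open>C * C\<^sup>T = 1\<close> makes \<open>z\<close> its
  output. The term \<open>m B C \<xi>\<close> is added to the linear part and subtracted from the
  input, which turns the gradient into the map behind \<open>Delta\<close>.\<close>

lemma algorithm_step_shift:
  fixes H :: "real^'p::finite \<Rightarrow> real"
  defines "z \<equiv> to_vec (minimizer H)"
  assumes C: "C \<in> carrier_mat CARD('p) N" "C * C\<^sup>T = 1\<^sub>m CARD('p)"
    and A: "A \<in> carrier_mat N N" "A * C\<^sup>T = C\<^sup>T" and B: "B \<in> carrier_mat N CARD('p)"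
    and x: "x \<in> carrier_vec N"
  shows "algorithm_step A B C H x - C\<^sup>T *\<^sub>v z =
    (A + m \<cdot>\<^sub>m (B * C)) *\<^sub>v (x - C\<^sup>T *\<^sub>v z) +
    B *\<^sub>v (to_vec (gradient H (of_vec (C *\<^sub>v (x - C\<^sup>T *\<^sub>v z)) + minimizer H)) -
      m \<cdot>\<^sub>v (C *\<^sub>v (x - C\<^sup>T *\<^sub>v z)))"
proof -
  define xs where "xs = C\<^sup>T *\<^sub>v z"
  define \<xi> where "\<xi> = x - xs"
  define g where "g = to_vec (gradient H (of_vec (C *\<^sub>v x)))"
  have z: "z \<in> carrier_vec CARD('p)" by (simp add: z_def)
  have xs: "xs \<in> carrier_vec N" using C(1) by (auto simp: xs_def intro!: carrier_vecI)
  have \<xi>: "\<xi> \<in> carrier_vec N" using x xs by (simp add: \<xi>_def)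
  have g: "g \<in> carrier_vec CARD('p)" by (simp add: g_def)
  have Cx: "C *\<^sub>v \<xi> \<in> carrier_vec CARD('p)" using C(1) by (auto intro!: carrier_vecI)
  have "C *\<^sub>v xs = (C * C\<^sup>T) *\<^sub>v z" using C(1) z by (simp add: xs_def mult_mat_mult_vec)
  then have Cxs: "C *\<^sub>v xs = z" using z by (simp add: C(2))
  have "A *\<^sub>v xs = (A * C\<^sup>T) *\<^sub>v z" using A(1) C(1) z by (simp add: xs_def mult_mat_mult_vec)
  then have Axs: "A *\<^sub>v xs = xs" by (simp add: A(2) xs_def)
  have x\<xi>: "x = \<xi> + xs" using x xs by (auto simp: \<xi>_def)
  have "C *\<^sub>v x = C *\<^sub>v \<xi> + z" unfolding x\<xi> mult_add_distrib_mat_vec[OF C(1) \<xi> xs] Cxs ..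
  then have gx: "to_vec (gradient H (of_vec (C *\<^sub>v \<xi>) + minimizer H)) = g"
    using Cx z by (simp add: g_def of_vec_add) (simp add: z_def)
  have "algorithm_step A B C H x = A *\<^sub>v \<xi> + xs + B *\<^sub>v g"
    unfolding algorithm_step_def g_def[symmetric]
    by (subst x\<xi>) (simp add: mult_add_distrib_mat_vec[OF A(1) \<xi> xs] Axs)
  moreover have "(A + m \<cdot>\<^sub>m (B * C)) *\<^sub>v \<xi> = A *\<^sub>v \<xi> + m \<cdot>\<^sub>v (B *\<^sub>v (C *\<^sub>v \<xi>))"
    using A(1) B C(1) \<xi>
    by (simp add: add_mult_distrib_mat_vec[of _ N N] smult_mat_mult_vec mult_mat_mult_vec)
  moreover have "B *\<^sub>v (g - m \<cdot>\<^sub>v (C *\<^sub>v \<xi>)) = B *\<^sub>v g - m \<cdot>\<^sub>v (B *\<^sub>v (C *\<^sub>v \<xi>))"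
    using mult_minus_distrib_mat_vec[OF B g smult_carrier_vec[THEN iffD2, OF Cx]] mult_mat_vec[OF B Cx] by simp
  ultimately have "algorithm_step A B C H x - xs =
      (A + m \<cdot>\<^sub>m (B * C)) *\<^sub>v \<xi> + B *\<^sub>v (g - m \<cdot>\<^sub>v (C *\<^sub>v \<xi>))"
    using A(1) B xs by (auto intro!: eq_vecI simp del: index_mult_mat_vec)
  then show ?thesis unfolding xs_def[symmetric] \<xi>_def[symmetric] gx .
qed

theorem theorem7:
  fixes m L \<rho> :: real and n p lm lp :: nat
    and C D Dd P11 P22 QA QB Mp Mm M0 A B :: "real mat"
  assumes "0 < m" and "m \<le> L"
    and "1 \<le> n" and "p = CARD('p::finite)"
    and "C = first_block n p" and "D = C" and "Dd = C\<^sup>T"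
    and "0 < \<rho>" and "\<rho> < 1"
    and "P11 \<in> carrier_mat (p * (lm + lp)) (p * (lm + lp))" and "P11\<^sup>T = P11"
    and "P22 \<in> carrier_mat (n * p) (n * p)" and "P22\<^sup>T = P22"
    and "QA \<in> carrier_mat (n * p) (n * p)" and "QB \<in> carrier_mat (n * p) p"
    and "Mp \<in> carrier_mat p (lp * p)" and "Mm \<in> carrier_mat p (lm * p)" and "M0 \<in> carrier_mat p p"
    and "neg_def (lmi_mat m L n p lm lp C \<rho> P11 P22 QA QB (M_Delta p lm lp Mm M0 Mp))"
    and "(QA - P22) * Dd = 0\<^sub>m (n * p) p"
    and "Mm @\<^sub>c M0 @\<^sub>c Mp \<in> multiplier_set \<rho> lp lm p"
    and "A = the (mat_inverse P22) * QA" and "B = the (mat_inverse P22) * QB"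
  shows "invertible_mat P22 \<and>
    equilibrium_robustly_exp_stable A B C Dd (S_class m L :: (real^'p \<Rightarrow> real) set) \<rho> \<and>
    robustly_exp_stable (A + m \<cdot>\<^sub>m (B * C)) B C (Delta m ` (S_class m L :: (real^'p \<Rightarrow> real) set)) \<rho>"
proof -
  let ?S = "S_class m L :: (real^'p \<Rightarrow> real) set"
  have C: "C \<in> carrier_mat p (n * p)" unfolding assms(5) by (rule first_block_carrier)
  interpret lmi m L \<rho> n p lm lp C P11 P22 QA QB Mp Mm M0
    by unfold_locales (use C assms in auto)
  obtain Y where Y: "mat_inverse P22 = Some Y" "Y \<in> carrier_mat (n * p) (n * p)"
    "P22 * Y = 1\<^sub>m (n * p)" "Y * P22 = 1\<^sub>m (n * p)" and inv: "invertible_mat P22"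
    using pos_def_invertible[OF P22(1) P22_pos] by blast
  have AY: "A = Y * QA" and BY: "B = Y * QB" using assms(22,23) Y(1) by auto
  have A: "A \<in> carrier_mat (n * p) (n * p)" using Y(2) QA by (simp add: AY)
  have B: "B \<in> carrier_mat (n * p) p" using Y(2) QB by (simp add: BY)
  have PA: "P22 * A = QA"
    unfolding AY using assoc_mult_mat[OF P22(1) Y(2) QA] Y(3) QA by simp
  have PB: "P22 * B = QB"
    unfolding BY using assoc_mult_mat[OF P22(1) Y(2) QB] Y(3) QB by simp
  have BC: "B * C \<in> carrier_mat (n * p) (n * p)" using B C by simp
  have PAc: "P22 * (A + m \<cdot>\<^sub>m (B * C)) = QA + m \<cdot>\<^sub>m (QB * C)"
    using mult_add_distrib_mat[OF P22(1) A smult_carrier_mat[OF BC]] PA PB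
      mult_smult_distrib[OF P22(1) BC] assoc_mult_mat[OF P22(1) B C] by simp
  \<comment> \<open>The linear constraint on \<open>QA\<close> is this fixed-point property of
    \<open>A\<close> multiplied by \<open>P22\<close>, which is now cancelled.\<close>
  have ACt: "A * C\<^sup>T = C\<^sup>T"
  proof -
    have Ct: "C\<^sup>T \<in> carrier_mat (n * p) p" using C by simp
    have zero: "QA * C\<^sup>T - P22 * C\<^sup>T = 0\<^sub>m (n * p) p"
      using assms(20) minus_mult_distrib_mat[OF QA P22(1) Ct] by (simp add: assms(7))
    have "QA * C\<^sup>T = P22 * C\<^sup>T"
    proof (rule eq_matI)
      fix i j assume ij: "i < dim_row (P22 * C\<^sup>T)" "j < dim_col (P22 * C\<^sup>T)"
      then show "(QA * C\<^sup>T) $$ (i, j) = (P22 * C\<^sup>T) $$ (i, j)"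
        using arg_cong[OF zero, of "\<lambda>X. X $$ (i, j)"] P22 QA Ct by (simp del: index_mult_mat(1))
    qed (use P22 QA in auto)
    then have "A * C\<^sup>T = (Y * P22) * C\<^sup>T"
      unfolding AY using assoc_mult_mat[OF Y(2) QA Ct] assoc_mult_mat[OF Y(2) P22(1) Ct] by simp
    then show ?thesis using Y(4) Ct by simp
  qed
  have CCt: "C * C\<^sup>T = 1\<^sub>m p" unfolding assms(5) by (rule first_block_mult_transpose[OF assms(3)])
  have Ac: "A + m \<cdot>\<^sub>m (B * C) \<in> carrier_mat (n * p) (n * p)" using A BC by simp
  have stable: "robustly_exp_stable (A + m \<cdot>\<^sub>m (B * C)) B C (Delta m ` ?S) \<rho>"
    by (rule closed_loop_stable[OF assms(4,1,2,8,21) Ac PAc B PB])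
  have fixed: "algorithm_step A B C H (Dd *\<^sub>v to_vec (minimizer H)) = Dd *\<^sub>v to_vec (minimizer H)"
    if "H \<in> ?S" for H
  proof -
    let ?z = "to_vec (minimizer H)"
    have z: "?z \<in> carrier_vec p" by (simp add: assms(4))
    have "C *\<^sub>v (C\<^sup>T *\<^sub>v ?z) = ?z" using mult_mat_mult_vec[of C "C\<^sup>T" ?z] CCt C z by simp
    moreover have "A *\<^sub>v (C\<^sup>T *\<^sub>v ?z) = C\<^sup>T *\<^sub>v ?z" using mult_mat_mult_vec[of A "C\<^sup>T" ?z] ACt A C z by simp
    moreover have "to_vec (0 :: real^'p) = 0\<^sub>v p" by (auto simp: to_vec_def assms(4) intro!: eq_vecI)
    ultimately show ?thesis using B C
      by (simp add: algorithm_step_def assms(7) S_class_gradient_minimizer[OF assms(1) that])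
  qed
  obtain \<eta> where \<eta>: "\<eta> > 0" and decay: "\<And>H \<xi> y w k. H \<in> ?S \<Longrightarrow> \<xi> 0 \<in> carrier_vec (n * p) \<Longrightarrow>
      (\<And>k. \<xi> (Suc k) = (A + m \<cdot>\<^sub>m (B * C)) *\<^sub>v \<xi> k + B *\<^sub>v w k) \<Longrightarrow> (\<And>k. y k = C *\<^sub>v \<xi> k) \<Longrightarrow>
      (\<And>k. w k = Delta m H y k) \<Longrightarrow>
      scalar_prod (\<xi> k) (\<xi> k) \<le> \<eta> * \<rho> ^ (2 * k) * scalar_prod (\<xi> 0) (\<xi> 0)"
    using stable Ac unfolding robustly_exp_stable_def by (metis carrier_matD(2) imageI)
  have "scalar_prod (x k - Dd *\<^sub>v to_vec (minimizer H)) (x k - Dd *\<^sub>v to_vec (minimizer H)) \<le>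
      \<eta> * \<rho> ^ (2 * k) * scalar_prod (x 0 - Dd *\<^sub>v to_vec (minimizer H)) (x 0 - Dd *\<^sub>v to_vec (minimizer H))"
    if H: "H \<in> ?S" and x0: "x 0 \<in> carrier_vec (n * p)" and step: "\<And>k. x (Suc k) = algorithm_step A B C H (x k)"
    for H x k
  proof -
    define \<xi> where "\<xi> j = x j - Dd *\<^sub>v to_vec (minimizer H)" for j
    have x: "x j \<in> carrier_vec (n * p)" for j
      by (cases j) (use x0 A B in \<open>auto simp: step algorithm_step_def intro!: carrier_vecI\<close>)
    \<comment> \<open>Relative to the equilibrium, a run of the algorithm is a trajectory of the
      deviation system with \<open>y = C \<xi>\<close> and \<open>w\<close> the resulting value of
      \<open>Delta\<close>, so the same \<open>\<eta>\<close> applies.\<close>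
    have "scalar_prod (\<xi> k) (\<xi> k) \<le> \<eta> * \<rho> ^ (2 * k) * scalar_prod (\<xi> 0) (\<xi> 0)"
    proof (rule decay[OF H])
      show "\<xi> 0 \<in> carrier_vec (n * p)" using C by (auto simp: \<xi>_def assms(7) intro!: carrier_vecI)
      show "\<xi> (Suc j) = (A + m \<cdot>\<^sub>m (B * C)) *\<^sub>v \<xi> j + B *\<^sub>v Delta m H (\<lambda>k. C *\<^sub>v \<xi> k) j" for j
        unfolding \<xi>_def step Delta_def assms(7)
        by (rule algorithm_step_shift) (use A B C CCt ACt x assms(4) in auto)
    qed auto
    then show ?thesis unfolding \<xi>_def .
  qed
  then have "equilibrium_robustly_exp_stable A B C Dd ?S \<rho>"
    unfolding equilibrium_robustly_exp_stable_def Let_def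
    using fixed \<eta> A by (metis carrier_matD(2))
  with inv stable show ?thesis by blast
qed

end
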